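(* Let $p_-<0<p_+$ and $\lambda_-,\lambda_+>0$ with $\frac{\lambda_+}{p_+}<-\frac{\lambda_-}{p_-}$. Let $(X,E)$ be the piecewise deterministic Markov process on $\mathbb{R}\times I$, $I=\{-1,1\}$, obtained by switching between $f_{-1}(x)=p_-x-x^3$ and $f_1(x)=p_+x-x^3$, with rate $\lambda_-$ of switching from $f_{-1}$ to $f_1$ and rate $\lambda_+$ of switching from $f_1$ to $f_{-1}$. Let $\mu$ and $\pi$ be the ergodic invariant probability measures of $(X,E)$ with $\mu((0,\infty)\times I)=1$ and $\pi((-\infty,0)\times I)=1$, respectively. Then $\mu$ and $\pi$ are absolutely continuous with respect to the product of Lebesgue measure on $\mathbb{R}$ and counting measure on $I$, and the corresponding invariant densities $\rho^\mu=(\rho_i^\mu)_{i\in I}$ and $\rho^\pi=(\rho_i^\pi)_{i\in I}$ are given, for $i\in I$, by $$\rho_i^{\mu}(x)=\rho_i^{\pi}(-x)=C\,x^{-\frac{\lambda_-}{p_-}-\frac{\lambda_+}{p_+}-1}\left(-p_-+x^2\right)^{\frac{\lambda_-}{2p_-}-\frac12(1-i)}\left(p_+-x^2\right)^{\frac{\lambda_+}{2p_+}-\frac12(1+i)}\mathbf{1}_{(0,\sqrt{p_+})}(x),$$ where $C$ is a normalizing constant (the same for $i=-1$ and $i=1$).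
   Context: The process $(X,E)$: $E=(E_t)_{t\ge0}$ is the continuous-time Markov chain on $I=\{-1,1\}$ that jumps from $-1$ to $1$ at rate $\lambda_-$ and from $1$ to $-1$ at rate $\lambda_+$ (rates independent of $X$), and $X$ solves $X_t=X_0+\int_0^t f_{E_s}(X_s)\,ds$. The pair $(X,E)$ is a Markov process with semigroup $(\mathsf{P}^t)$. An invariant probability measure (IPM) is a probability measure $\mu$ on $\mathbb{R}\times I$ with $\mu\mathsf{P}^t=\mu$ for all $t\ge0$. An IPM $\nu$ is ergodic if $\nu(A)\in\{0,1\}$ for every measurable set $A$ of the state space such that for all $t\ge0$, $\mathsf{P}^t_z(A)=1$ for $\nu$-almost every $z\in A$. Under the assumption $\frac{\lambda_+}{p_+}<-\frac{\lambda_-}{p_-}$ there is exactly one ergodic IPM $\mu$ with $\mu((0,\infty)\times I)=1$ and exactly one ergodic IPM $\pi$ with $\pi((-\infty,0)\times I)=1$. If an IPM is absolutely continuous with respect to (Lebesgue measure on $\mathbb{R}$) $\times$ (counting measure on $I$) with density $\rho(x,i)$, its invariant densities are $\rho_i=\rho(\cdot,i)$, $i\in I$. The right-hand side of the formula is understood to be $0$ for $x\notin(0,\sqrt{p_+})$, and densities are determined up to Lebesgue-null sets. *)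

theory Defs
  imports "HOL-Probability.Probability"
begin

definition state_space :: "(real \<times> int) measure" where
  "state_space = borel \<Otimes>\<^sub>M count_space {-1, 1}"

definition reference_measure :: "(real \<times> int) measure" where
  "reference_measure = lborel \<Otimes>\<^sub>M count_space {-1, 1}"

text \<open>In the parameter lists below, \<open>pm, pp, lm, lp\<close> are
  \<open>p\<^sub>-, p\<^sub>+, \<lambda>\<^sub>-, \<lambda>\<^sub>+\<close>.\<close>

definition vector_field :: "real \<Rightarrow> real \<Rightarrow> int \<Rightarrow> real \<Rightarrow> real" where
  "vector_field pm pp i x = (if i = 1 then pp else pm) * x - x ^ 3"

definition jump_rate :: "real \<Rightarrow> real \<Rightarrow> int \<Rightarrow> real" where
  "jump_rate lm lp i = (if i = 1 then lp else lm)"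

text \<open>The continuous-time Markov chain on \<open>{-1, 1}\<close> started at \<open>i\<close>, in its jump
  chain/holding time form: after \<open>n\<close> jumps the chain is in state \<open>i * (-1) ^ n\<close>, where it stays
  for an exponential time \<open>S n\<close> with parameter the rate of leaving that state, and the holding
  times are independent. The partial sums of \<open>S\<close> almost surely diverge, so that every \<open>t \<ge> 0\<close>
  lies in exactly one of the holding intervals.\<close>

definition switching_chain ::
  "real \<Rightarrow> real \<Rightarrow> 'w measure \<Rightarrow> int \<Rightarrow> (real \<Rightarrow> 'w \<Rightarrow> int) \<Rightarrow> bool" where
  "switching_chain lm lp M i E \<longleftrightarrow>
     prob_space M \<and>
     (\<forall>t\<ge>0. E t \<in> M \<rightarrow>\<^sub>M count_space {-1, 1}) \<and>
     (\<exists>S :: nat \<Rightarrow> 'w \<Rightarrow> real.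
        prob_space.indep_vars M (\<lambda>_. borel) S UNIV \<and>
        (\<forall>n. distributed M lborel (S n)
               (exponential_density (jump_rate lm lp (i * (-1) ^ n)))) \<and>
        (AE \<omega> in M. \<forall>n. \<forall>t. (\<Sum>k<n. S k \<omega>) \<le> t \<and> t < (\<Sum>k<Suc n. S k \<omega>)
               \<longrightarrow> E t \<omega> = i * (-1) ^ n))"

text \<open>A realization of the process \<open>(X, E)\<close> on the probability space \<open>M\<close> with initial
  state \<open>z = (x, i)\<close>.\<close>

definition switching_process ::
  "real \<Rightarrow> real \<Rightarrow> real \<Rightarrow> real \<Rightarrow> 'w measure \<Rightarrow> real \<times> int
     \<Rightarrow> (real \<Rightarrow> 'w \<Rightarrow> real) \<Rightarrow> (real \<Rightarrow> 'w \<Rightarrow> int) \<Rightarrow> bool" where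
  "switching_process pm pp lm lp M z X E \<longleftrightarrow>
     switching_chain lm lp M (snd z) E \<and>
     (\<forall>t\<ge>0. X t \<in> borel_measurable M) \<and>
     (AE \<omega> in M. \<forall>t\<ge>0.
        ((\<lambda>s. vector_field pm pp (E s \<omega>) (X s \<omega>)) has_integral (X t \<omega> - fst z)) {0..t})"

text \<open>\<open>P t z\<close> is the law at time \<open>t\<close> of the process started at \<open>z\<close>. As usual for transition
  semigroups, each \<open>P t\<close> is a Markov kernel, i.e. measurable in the initial state.\<close>

definition transition_semigroup ::
  "(real \<times> int \<Rightarrow> 'w measure) \<Rightarrow> (real \<times> int \<Rightarrow> real \<Rightarrow> 'w \<Rightarrow> real)
     \<Rightarrow> (real \<times> int \<Rightarrow> real \<Rightarrow> 'w \<Rightarrow> int)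
     \<Rightarrow> (real \<Rightarrow> real \<times> int \<Rightarrow> (real \<times> int) measure) \<Rightarrow> bool" where
  "transition_semigroup M X E P \<longleftrightarrow>
     (\<forall>t\<ge>0. P t \<in> state_space \<rightarrow>\<^sub>M prob_algebra state_space \<and>
        (\<forall>z\<in>space state_space.
           P t z = distr (M z) state_space (\<lambda>\<omega>. (X z t \<omega>, E z t \<omega>))))"

definition invariant_prob ::
  "(real \<Rightarrow> real \<times> int \<Rightarrow> (real \<times> int) measure) \<Rightarrow> (real \<times> int) measure \<Rightarrow> bool" where
  "invariant_prob P \<mu> \<longleftrightarrow>
     prob_space \<mu> \<and> sets \<mu> = sets state_space \<and> (\<forall>t\<ge>0. \<mu> \<bind> P t = \<mu>)"

definition ergodic_invariant_prob ::
  "(real \<Rightarrow> real \<times> int \<Rightarrow> (real \<times> int) measure) \<Rightarrow> (real \<times> int) measure \<Rightarrow> bool" where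
  "ergodic_invariant_prob P \<nu> \<longleftrightarrow>
     invariant_prob P \<nu> \<and>
     (\<forall>A\<in>sets state_space.
        (\<forall>t\<ge>0. AE z in \<nu>. z \<in> A \<longrightarrow> measure (P t z) A = 1)
          \<longrightarrow> measure \<nu> A \<in> {0, 1})"

definition is_invariant_density ::
  "(real \<times> int) measure \<Rightarrow> (int \<Rightarrow> real \<Rightarrow> real) \<Rightarrow> bool" where
  "is_invariant_density \<mu> \<rho> \<longleftrightarrow>
     (\<forall>i\<in>{-1, 1}. \<rho> i \<in> borel_measurable borel \<and> (\<forall>x. 0 \<le> \<rho> i x)) \<and>
     \<mu> = density reference_measure (\<lambda>(x, i). ennreal (\<rho> i x))"

end

theory Submission
  imports Defs
begin

text \<open>Up to the second jump, a path of \<open>X\<close> is an integral curve of one vector field followed by an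
  integral curve of the other, so for a bounded \<open>C\<^sup>1\<close> function \<open>\<phi>\<close> with bounded \<open>f\<^sub>i \<phi>\<^sub>j'\<close> the law at a
  small time \<open>t\<close> satisfies \<open>P\<^sub>t \<phi> = \<phi> + t L \<phi> + o(t)\<close>, and invariance gives \<open>\<integral> L \<phi> d\<mu> = 0\<close>.
  Let \<open>\<mu>\<^sub>1, \<mu>\<^sub>-\<^sub>1\<close> be the two marginals on \<open>(0, \<infinity>)\<close>. Taking \<open>\<phi>\<^sub>1 = \<phi>\<^sub>-\<^sub>1\<close> shows that the net flux
  \<open>f\<^sub>1 \<mu>\<^sub>1 + f\<^sub>-\<^sub>1 \<mu>\<^sub>-\<^sub>1\<close> vanishes; since both fields are negative beyond \<open>\<surd>p\<^sub>+\<close>, there is no mass there, and test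
  functions concentrating at \<open>\<surd>p\<^sub>+\<close> exclude an atom, as \<open>f\<^sub>1\<close> vanishes to first order at that point.
  Taking \<open>\<phi>\<^sub>1 = u / g\<close> and \<open>\<phi>\<^sub>-\<^sub>1 = 0\<close> with the integrating factor \<open>g\<close> shows \<open>\<integral> (f\<^sub>1 / g) u' d\<mu>\<^sub>1 = 0\<close>
  for all compactly supported \<open>u\<close>, so that \<open>(f\<^sub>1 / g) \<mu>\<^sub>1\<close> is a multiple of Lebesgue measure.
  Total mass one fixes the multiple, and the reflection \<open>x \<mapsto> - x\<close> carries \<open>\<pi>\<close> to the positive half-line.\<close>

section \<open>Integral curves\<close>

lemma integral_curve_continuous_on:
  fixes g X :: "real \<Rightarrow> real"
  assumes "\<And>s. 0 \<le> s \<Longrightarrow> (g has_integral (X s - x)) {0..s}"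
  shows "continuous_on {0..t} X"
proof (cases "0 \<le> t")
  case True
  have X: "X s = x + integral {0..s} g" if "s \<in> {0..t}" for s
    using integral_unique[OF assms[of s]] that by auto
  have "g integrable_on {0..t}" using assms True by blast
  then have "continuous_on {0..t} (\<lambda>s. x + integral {0..s} g)"
    by (intro continuous_intros indefinite_integral_continuous_1)
  then show ?thesis using X by (metis (no_types, lifting) continuous_on_cong)
qed auto

text \<open>The fundamental theorem of calculus is applied to \<open>\<phi> (X s)\<close>, with
  integrand \<open>\<phi>' (X s) * g s\<close>. The exceptional time \<open>\<tau>\<close> is where
  a jump of the chain makes the velocity \<open>g\<close> discontinuous, so that \<open>X\<close>
  need not be differentiable there.\<close>

lemma integral_curve_bound:
  fixes g X \<phi> \<phi>' :: "real \<Rightarrow> real"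
  assumes g: "\<And>s. 0 \<le> s \<Longrightarrow> (g has_integral (X s - x)) {0..s}"
    and cont: "\<And>s. s \<in> {0<..<t} - {\<tau>} \<Longrightarrow> isCont g s"
    and \<phi>: "\<And>y. (\<phi> has_real_derivative \<phi>' y) (at y)"
    and K: "\<And>s. s \<in> {0<..<t} \<Longrightarrow> \<bar>g s * \<phi>' (X s)\<bar> \<le> K" "0 \<le> K"
    and t: "0 \<le> t"
  shows "\<bar>\<phi> (X t) - \<phi> x\<bar> \<le> K * t"
proof -
  have X0: "X 0 = x"
    using has_integral_unique[OF g[of 0]] has_integral_refl(1)[of g 0] by fastforce
  have X: "X s = x + integral {0..s} g" if "0 \<le> s" for s
    using integral_unique[OF g[OF that]] by auto
  have gi: "g integrable_on {0..t}" using g t by blast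
  have contX: "continuous_on {0..t} X"
    using g by (rule integral_curve_continuous_on)
  have \<phi>c: "continuous_on UNIV \<phi>"
    using \<phi> by (meson DERIV_isCont continuous_at_imp_continuous_on)
  have XD: "(X has_real_derivative g s) (at s)" if s: "s \<in> {0<..<t} - {\<tau>}" for s
  proof -
    have "((\<lambda>u. integral {0..u} g) has_vector_derivative g s) (at s within ({0..t} - {}))"
      using s cont[OF s] gi
      by (intro integral_has_vector_derivative_continuous_at) (auto intro: continuous_at_imp_continuous_at_within)
    then have "((\<lambda>u. integral {0..u} g) has_vector_derivative g s) (at s)"
      using s by (simp add: at_within_Icc_at)
    then have "((\<lambda>u. x + integral {0..u} g) has_vector_derivative g s) (at s)"
      by (auto intro!: derivative_eq_intros)
    moreover have "\<forall>\<^sub>F u in nhds s. X u = x + integral {0..u} g"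
      using s by (intro eventually_mono[OF eventually_nhds_in_open[of "{0<..<t}" s]]) (auto intro: X)
    ultimately show ?thesis
      by (simp add: has_real_derivative_iff_has_vector_derivative[symmetric] DERIV_cong_ev)
  qed
  \<comment> \<open>The value 0 at \<open>\<tau>\<close> is a default that does not affect the
    integral. The end points, at which no bound is available, form the finite exceptional set
    \<open>{0,t}\<close> below.\<close>
  let ?G = "\<lambda>s. if s = \<tau> then 0 else \<phi>' (X s) * g s"
  have "(?G has_integral (\<phi> (X t) - \<phi> (X 0))) {0..t}"
  proof (rule fundamental_theorem_of_calculus_interior_strong[where S="{\<tau>}"])
    show "continuous_on {0..t} (\<lambda>s. \<phi> (X s))"
      using continuous_on_compose2[OF \<phi>c contX] by auto
    fix s assume s: "s \<in> {0<..<t} - {\<tau>}"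
    show "((\<lambda>s. \<phi> (X s)) has_vector_derivative ?G s) (at s)"
      using DERIV_chain2[OF \<phi> XD[OF s]] s
      by (simp add: has_real_derivative_iff_has_vector_derivative)
  qed (use t in auto)
  then have "norm (\<phi> (X t) - \<phi> (X 0)) \<le> K * measure lborel {0..t}"
    by (rule has_integral_bound_real[rotated 2, where S="{0,t}"])
      (use K in \<open>auto simp: mult.commute abs_mult\<close>)
  then show ?thesis using X0 t by auto
qed

text \<open>While the velocity is a continuous function \<open>h\<close> of the position,
  \<open>g\<close> is continuous on \<open>{0..t}\<close> and \<open>X\<close> has a right
  derivative at 0. This yields the drift part of the generator on paths that have not jumped
  yet.\<close>

lemma integral_curve_right_derivative:
  fixes g X \<phi> \<phi>' :: "real \<Rightarrow> real"
  assumes g: "\<And>s. 0 \<le> s \<Longrightarrow> (g has_integral (X s - x)) {0..s}"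
    and h: "\<And>s. s \<in> {0..t} \<Longrightarrow> g s = h (X s)" "continuous_on UNIV h"
    and \<phi>: "\<And>y. (\<phi> has_real_derivative \<phi>' y) (at y)"
    and t: "0 < t"
  shows "((\<lambda>s. (\<phi> (X s) - \<phi> x) / s) \<longlongrightarrow> h x * \<phi>' x) (at_right 0)"
proof -
  have X0: "X 0 = x"
    using has_integral_unique[OF g[of 0]] has_integral_refl(1)[of g 0] by fastforce
  have X: "X s = x + integral {0..s} g" if "0 \<le> s" for s
    using integral_unique[OF g[OF that]] by auto
  have "continuous_on {0..t} (\<lambda>s. h (X s))"
    using continuous_on_compose2[OF h(2) integral_curve_continuous_on[OF g]] by auto
  then have "continuous_on {0..t} g" using h(1) by (metis (no_types, lifting) continuous_on_cong)
  then have "((\<lambda>s. integral {0..s} g) has_real_derivative g 0) (at 0 within {0..t})"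
    using t by (intro integral_has_real_derivative) auto
  then have "((\<lambda>s. x + integral {0..s} g) has_real_derivative g 0) (at 0 within {0..t})"
    by (auto intro!: derivative_eq_intros)
  then have "(X has_real_derivative g 0) (at 0 within {0..t})"
    by (rule has_field_derivative_transform_within[where d=1]) (use t X in auto)
  then have "((\<lambda>s. \<phi> (X s)) has_real_derivative \<phi>' (X 0) * g 0) (at 0 within {0..t})"
    by (rule DERIV_chain2[OF \<phi>])
  then show ?thesis
    using t h(1)[of 0] unfolding has_field_derivative_iff X0
    by (simp add: at_within_Icc_at_right mult.commute X0)
qed

section \<open>The generator\<close>

lemma space_state_space: "space state_space = UNIV \<times> {-1, 1}"
  by (simp add: state_space_def space_pair_measure)

text \<open>The second coordinate takes only two values, so measurability on each of the two slices
  gives joint measurability.\<close>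

lemma measurable_state_space_case:
  assumes "\<And>j. j \<in> {-1, 1} \<Longrightarrow> f j \<in> borel_measurable borel"
  shows "(\<lambda>z. f (snd z) (fst z)) \<in> borel_measurable state_space"
proof -
  have "(\<lambda>z::real \<times> int. if snd z = 1 then f 1 (fst z) else f (-1) (fst z)) \<in> borel_measurable state_space"
  proof (rule measurable_If)
    have [measurable]: "f 1 \<in> borel_measurable borel" "f (-1) \<in> borel_measurable borel"
      using assms by auto
    show "(\<lambda>z. f 1 (fst z)) \<in> borel_measurable state_space"
      "(\<lambda>z. f (-1) (fst z)) \<in> borel_measurable state_space"
      unfolding state_space_def by measurable
    have "{z \<in> space state_space. snd z = 1} = UNIV \<times> {1}"
      by (auto simp: space_state_space)
    also have "\<dots> \<in> sets state_space"
      unfolding state_space_def by (intro pair_measureI) auto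
    finally show "{z \<in> space state_space. snd z = 1} \<in> sets state_space" .
  qed
  then show ?thesis
    by (rule measurable_cong[THEN iffD1, rotated]) (auto simp: space_state_space)
qed

text \<open>The derivative \<open>\<phi>'\<close> is a separate argument, tied to
  \<open>\<phi>\<close> by \<open>test_function\<close>; \<open>- snd z\<close> is the other state
  of the chain.\<close>

definition generator ::
  "real \<Rightarrow> real \<Rightarrow> real \<Rightarrow> real \<Rightarrow> (int \<Rightarrow> real \<Rightarrow> real) \<Rightarrow> (int \<Rightarrow> real \<Rightarrow> real) \<Rightarrow> real \<times> int \<Rightarrow> real"
where
  "generator pm pp lm lp \<phi> \<phi>' z =
     vector_field pm pp (snd z) (fst z) * \<phi>' (snd z) (fst z)
       + jump_rate lm lp (snd z) * (\<phi> (- snd z) (fst z) - \<phi> (snd z) (fst z))"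

text \<open>The constants serve for dominated convergence, uniformly in the starting point.
  \<open>K\<close> also bounds the mixed products with \<open>i \<noteq> j\<close>, because just
  after a jump the increment of the new component \<open>\<phi> j\<close> was partly produced by the
  old field.\<close>

definition test_function ::
  "real \<Rightarrow> real \<Rightarrow> (int \<Rightarrow> real \<Rightarrow> real) \<Rightarrow> (int \<Rightarrow> real \<Rightarrow> real) \<Rightarrow> real \<Rightarrow> real \<Rightarrow> bool"
where
  "test_function pm pp \<phi> \<phi>' B K \<longleftrightarrow>
     (\<forall>j x. (\<phi> j has_real_derivative \<phi>' j x) (at x)) \<and>
     (\<forall>j. continuous_on UNIV (\<phi>' j)) \<and>
     (\<forall>j x. \<bar>\<phi> j x\<bar> \<le> B) \<and>
     (\<forall>i\<in>{-1, 1}. \<forall>j x. \<bar>vector_field pm pp i x * \<phi>' j x\<bar> \<le> K)"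

lemma continuous_vector_field: "continuous_on A (vector_field pm pp i)"
  unfolding vector_field_def by (intro continuous_intros)

lemma test_function_measurable:
  assumes "test_function pm pp \<phi> \<phi>' B K"
  shows "\<phi> j \<in> borel_measurable borel" "\<phi>' j \<in> borel_measurable borel"
proof -
  have "continuous_on UNIV (\<phi> j)"
    using assms unfolding test_function_def
    by (meson DERIV_isCont continuous_at_imp_continuous_on)
  then show "\<phi> j \<in> borel_measurable borel" by (rule borel_measurable_continuous_onI)
  show "\<phi>' j \<in> borel_measurable borel"
    using assms unfolding test_function_def by (auto intro: borel_measurable_continuous_onI)
qed

lemma measurable_generator:
  assumes "test_function pm pp \<phi> \<phi>' B K"
  shows "generator pm pp lm lp \<phi> \<phi>' \<in> borel_measurable state_space"
proof -
  note [measurable] = test_function_measurable[OF assms]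
  have [measurable]: "vector_field pm pp j \<in> borel_measurable borel" for j
    by (intro borel_measurable_continuous_onI continuous_vector_field)
  have "(\<lambda>z. (\<lambda>j x. vector_field pm pp j x * \<phi>' j x + jump_rate lm lp j * (\<phi> (- j) x - \<phi> j x))
      (snd z) (fst z)) \<in> borel_measurable state_space"
    by (rule measurable_state_space_case) measurable
  then show ?thesis
    by (simp add: generator_def[abs_def])
qed

section \<open>Holding times and the short-time expansion of the semigroup\<close>

locale switching_rates =
  fixes pm pp lm lp :: real
  assumes lm: "0 < lm" and lp: "0 < lp"
begin

lemma rate_pos: "0 < jump_rate lm lp j"
  using lm lp by (simp add: jump_rate_def)

text \<open>Two jumps by time \<open>t\<close> force both holding times to be at most
  \<open>t\<close>. By independence and \<open>1 - exp (- u) \<le> u\<close> this has probability of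
  order \<open>t\<^sup>2\<close>, which keeps multiple jumps within the o(t) error of the
  expansion.\<close>

lemma first_holding_times:
  assumes "switching_chain lm lp M i E" "i \<in> {-1, 1}"
  obtains S\<^sub>0 S\<^sub>1 :: "'w \<Rightarrow> real" where
    "S\<^sub>0 \<in> borel_measurable M" "S\<^sub>1 \<in> borel_measurable M"
    "AE \<omega> in M. 0 < S\<^sub>0 \<omega> \<and> 0 < S\<^sub>1 \<omega>"
    "\<And>t. 0 \<le> t \<Longrightarrow> measure M {\<omega> \<in> space M. S\<^sub>0 \<omega> \<le> t} = 1 - exp (- t * jump_rate lm lp i)"
    "\<And>t. 0 \<le> t \<Longrightarrow> measure M {\<omega> \<in> space M. S\<^sub>0 \<omega> \<le> t \<and> S\<^sub>1 \<omega> \<le> t}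
       \<le> (jump_rate lm lp i * t) * (jump_rate lm lp (- i) * t)"
    "AE \<omega> in M. \<forall>t\<ge>0. t < S\<^sub>0 \<omega> \<longrightarrow> E t \<omega> = i"
    "AE \<omega> in M. \<forall>t\<ge>0. S\<^sub>0 \<omega> \<le> t \<and> t < S\<^sub>0 \<omega> + S\<^sub>1 \<omega> \<longrightarrow> E t \<omega> = - i"
proof -
  obtain S :: "nat \<Rightarrow> 'w \<Rightarrow> real" where ps: "prob_space M"
    and ind: "prob_space.indep_vars M (\<lambda>_. borel) S UNIV"
    and dist: "\<And>n. distributed M lborel (S n) (exponential_density (jump_rate lm lp (i * (-1) ^ n)))"
    and ES: "AE \<omega> in M. \<forall>n. \<forall>t. (\<Sum>k<n. S k \<omega>) \<le> t \<and> t < (\<Sum>k<Suc n. S k \<omega>)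
               \<longrightarrow> E t \<omega> = i * (-1) ^ n"
    using assms(1) unfolding switching_chain_def by blast
  interpret prob_space M by (rule ps)
  have meas[measurable]: "S n \<in> borel_measurable M" for n
    using dist[of n] by (simp add: distributed_def)
  have le: "prob {\<omega> \<in> space M. S n \<omega> \<le> t} = 1 - exp (- t * jump_rate lm lp (i * (-1) ^ n))"
    if "0 \<le> t" for n t
    using exponential_distributedD_le[OF dist that rate_pos] .
  have le': "prob {\<omega> \<in> space M. S n \<omega> \<le> t} \<le> jump_rate lm lp (i * (-1) ^ n) * t"
    if "0 \<le> t" for n t
    using le[OF that, of n] exp_ge_add_one_self[of "- t * jump_rate lm lp (i * (-1) ^ n)"]
    by (simp add: mult.commute)
  have pos: "AE \<omega> in M. 0 < S n \<omega>" for n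
  proof -
    have "prob {\<omega> \<in> space M. S n \<omega> \<le> 0} = 0" using le[of 0 n] by simp
    then have "AE \<omega> in M. \<not> S n \<omega> \<le> 0"
      by (subst (asm) prob_eq_0) auto
    then show ?thesis by (simp add: not_le)
  qed
  show ?thesis
  proof (rule that[of "S 0" "S 1"])
    show "S 0 \<in> borel_measurable M" "S 1 \<in> borel_measurable M" by (rule meas)+
    show "AE \<omega> in M. 0 < S 0 \<omega> \<and> 0 < S 1 \<omega>" using pos by simp
    fix t :: real assume t: "0 \<le> t"
    show "prob {\<omega> \<in> space M. S 0 \<omega> \<le> t} = 1 - exp (- t * jump_rate lm lp i)"
      using le[OF t, of 0] by simp
    have "prob {\<omega> \<in> space M. S 0 \<omega> \<le> t \<and> S 1 \<omega> \<le> t} = prob (\<Inter>n\<in>{0,1::nat}. S n -` {..t} \<inter> space M)"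
      by (intro arg_cong[where f=prob]) auto
    also have "\<dots> = (\<Prod>n\<in>{0,1::nat}. prob (S n -` {..t} \<inter> space M))"
      by (rule indep_varsD[OF ind]) auto
    also have "\<dots> = prob {\<omega> \<in> space M. S 0 \<omega> \<le> t} * prob {\<omega> \<in> space M. S 1 \<omega> \<le> t}"
      by (simp add: vimage_def Int_def conj_commute)
    also have "\<dots> \<le> (jump_rate lm lp i * t) * (jump_rate lm lp (- i) * t)"
      using le'[OF t, of 0] le'[OF t, of 1] t rate_pos[of i]
      by (intro mult_mono) (auto intro: mult_nonneg_nonneg)
    finally show "prob {\<omega> \<in> space M. S 0 \<omega> \<le> t \<and> S 1 \<omega> \<le> t}
       \<le> (jump_rate lm lp i * t) * (jump_rate lm lp (- i) * t)" .
  next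
    show "AE \<omega> in M. \<forall>t\<ge>0. t < S 0 \<omega> \<longrightarrow> E t \<omega> = i"
      using ES
    proof eventually_elim
      case (elim \<omega>)
      show ?case using elim[rule_format, of 0] by auto
    qed
    show "AE \<omega> in M. \<forall>t\<ge>0. S 0 \<omega> \<le> t \<and> t < S 0 \<omega> + S 1 \<omega> \<longrightarrow> E t \<omega> = - i"
      using ES
    proof eventually_elim
      case (elim \<omega>)
      show ?case using elim[rule_format, of 1] by (auto simp: lessThan_Suc)
    qed
  qed
qed

text \<open>Before the second jump the chain changes at most once, at \<open>\<tau>\<close>, so the
  velocity has at most one discontinuity in \<open>{0<..<t}\<close> and the bound for integral
  curves applies. The component \<open>j\<close> is independent of the field that is
  running.\<close>

lemma path_increment_before_second_jump:
  fixes X :: "real \<Rightarrow> real" and e :: "real \<Rightarrow> int"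
  assumes tf: "test_function pm pp \<phi> \<phi>' B K"
    and X: "\<And>t. 0 \<le> t \<Longrightarrow> ((\<lambda>s. vector_field pm pp (e s) (X s)) has_integral (X t - x)) {0..t}"
    and e: "\<And>s. 0 \<le> s \<Longrightarrow> s < \<tau> \<Longrightarrow> s \<le> t \<Longrightarrow> e s = i" "\<And>s. 0 \<le> s \<Longrightarrow> \<tau> \<le> s \<Longrightarrow> s \<le> t \<Longrightarrow> e s = - i"
    and i: "i \<in> {-1, 1}" and t: "0 \<le> t"
  shows "\<bar>\<phi> j (X t) - \<phi> j x\<bar> \<le> K * t"
proof (rule integral_curve_bound[OF X, where \<tau>=\<tau> and \<phi>'="\<phi>' j"])
  have K: "\<bar>vector_field pm pp i x * \<phi>' j x\<bar> \<le> K" if "i \<in> {-1,1}" for i x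
    using tf that unfolding test_function_def by blast
  show "0 \<le> K" using K[of 1 0] by (simp add: vector_field_def)
  show "(\<phi> j has_real_derivative \<phi>' j y) (at y)" for y
    using tf by (simp add: test_function_def)
  show "\<bar>vector_field pm pp (e s) (X s) * \<phi>' j (X s)\<bar> \<le> K" if "s \<in> {0<..<t}" for s
    using that i e[of s] by (intro K) (cases "s < \<tau>"; auto)
  fix s assume s: "s \<in> {0<..<t} - {\<tau>}"
  have XC: "continuous_on {0<..<t} X"
    using integral_curve_continuous_on[OF X, where t=t] by (rule continuous_on_subset) auto
  have C: "isCont (\<lambda>s. vector_field pm pp k (X s)) s" for k
    using continuous_on_compose2[OF continuous_vector_field[of UNIV] XC] s
    by (auto simp: continuous_on_eq_continuous_at)
  \<comment> \<open>Away from \<open>\<tau>\<close> the chain is locally constant, so near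
    \<open>s\<close> the integrand agrees with one continuous field along \<open>X\<close>.\<close>
  have ev: "\<forall>\<^sub>F u in nhds s. vector_field pm pp (e u) (X u) = vector_field pm pp (e s) (X u)"
  proof (cases "s < \<tau>")
    case True
    then show ?thesis
      using s e by (intro eventually_mono[OF eventually_nhds_in_open[of "{0<..<min t \<tau>}" s]]) auto
  next
    case False
    then show ?thesis
      using s e by (intro eventually_mono[OF eventually_nhds_in_open[of "{max 0 \<tau><..<t}" s]]) auto
  qed
  show "isCont (\<lambda>s. vector_field pm pp (e s) (X s)) s"
    using isCont_cong[OF ev] C by simp
qed (auto intro: t)

text \<open>The expectation splits according to the jumps up to time \<open>t\<close>: no jump
  contributes the drift, one jump contributes the switching term, and the rest is of order
  \<open>t\<^sup>2\<close>. The first conclusion, linear in \<open>t\<close> and uniform in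
  \<open>x\<close>, dominates the difference quotients when they are integrated against an invariant
  measure. The limit runs along the times 1/(n+1), since dominated convergence is applied to
  sequences.\<close>

lemma short_time_expansion:
  fixes X :: "real \<Rightarrow> 'w \<Rightarrow> real"
  assumes sp: "switching_process pm pp lm lp M (x, i) X E" and i: "i \<in> {-1, 1}"
    and tf: "test_function pm pp \<phi> \<phi>' B K"
  defines "\<kappa>\<^sub>i \<equiv> jump_rate lm lp i" and "\<kappa>\<^sub>j \<equiv> jump_rate lm lp (- i)"
    and "\<Delta> \<equiv> \<lambda>t. (\<integral>\<omega>. \<phi> (E t \<omega>) (X t \<omega>) \<partial>M) - \<phi> i x"
  shows short_time_bound: "\<And>t. 0 \<le> t \<Longrightarrow> \<bar>\<Delta> t\<bar> \<le> (K + 2 * B * \<kappa>\<^sub>i) * t"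
    and short_time_limit:
      "(\<lambda>n. \<Delta> (inverse (real (Suc n))) / inverse (real (Suc n)))
         \<longlonglongrightarrow> generator pm pp lm lp \<phi> \<phi>' (x, i)"
proof -
  have chain: "switching_chain lm lp M i E" and Xm[measurable]: "\<And>t. 0 \<le> t \<Longrightarrow> X t \<in> borel_measurable M"
    and Xint: "AE \<omega> in M. \<forall>t\<ge>0.
        ((\<lambda>s. vector_field pm pp (E s \<omega>) (X s \<omega>)) has_integral (X t \<omega> - x)) {0..t}"
    using sp by (auto simp: switching_process_def)
  interpret prob_space M using chain by (simp add: switching_chain_def)
  have Em: "E t \<in> M \<rightarrow>\<^sub>M count_space {-1, 1}" if "0 \<le> t" for t
    using chain that by (simp add: switching_chain_def)
  obtain S\<^sub>0 S\<^sub>1 where S_meas[measurable]: "S\<^sub>0 \<in> borel_measurable M" "S\<^sub>1 \<in> borel_measurable M"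
    and S_pos: "AE \<omega> in M. 0 < S\<^sub>0 \<omega> \<and> 0 < S\<^sub>1 \<omega>"
    and pS: "\<And>t. 0 \<le> t \<Longrightarrow> prob {\<omega> \<in> space M. S\<^sub>0 \<omega> \<le> t} = 1 - exp (- t * jump_rate lm lp i)"
    and pSS: "\<And>t. 0 \<le> t \<Longrightarrow> prob {\<omega> \<in> space M. S\<^sub>0 \<omega> \<le> t \<and> S\<^sub>1 \<omega> \<le> t} \<le> (jump_rate lm lp i * t) * (jump_rate lm lp (- i) * t)"
    and E0: "AE \<omega> in M. \<forall>t\<ge>0. t < S\<^sub>0 \<omega> \<longrightarrow> E t \<omega> = i"
    and E1: "AE \<omega> in M. \<forall>t\<ge>0. S\<^sub>0 \<omega> \<le> t \<and> t < S\<^sub>0 \<omega> + S\<^sub>1 \<omega> \<longrightarrow> E t \<omega> = - i"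
    by (rule first_holding_times[OF chain i]) (rule that; assumption)
  note pS = pS[folded \<kappa>\<^sub>i_def] and pSS = pSS[folded \<kappa>\<^sub>i_def \<kappa>\<^sub>j_def]
  have \<kappa>_pos: "0 < \<kappa>\<^sub>i" "0 < \<kappa>\<^sub>j" using rate_pos by (auto simp: \<kappa>\<^sub>i_def \<kappa>\<^sub>j_def)
  have pS_le: "prob {\<omega> \<in> space M. S\<^sub>0 \<omega> \<le> t} \<le> \<kappa>\<^sub>i * t" if "0 \<le> t" for t
    using pS[OF that] exp_ge_add_one_self[of "- t * \<kappa>\<^sub>i"] by (simp add: mult.commute)
  have B: "\<bar>\<phi> j y\<bar> \<le> B" for j y using tf by (simp add: test_function_def)
  have B0: "0 \<le> B" using B[of 0 0] by linarith
  have BB: "\<bar>\<phi> j y - \<phi> k v\<bar> \<le> 2 * B" for j y k v using B[of j y] B[of k v] by linarith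
  have "\<bar>vector_field pm pp 1 0 * \<phi>' 1 0\<bar> \<le> K" using tf unfolding test_function_def by blast
  then have K0: "0 \<le> K" by (simp add: vector_field_def)
  note [measurable] = test_function_measurable[OF tf]
  have Ym: "(\<lambda>\<omega>. \<phi> (E t \<omega>) (X t \<omega>)) \<in> borel_measurable M" if "0 \<le> t" for t
  proof -
    have "(\<lambda>\<omega>. (X t \<omega>, E t \<omega>)) \<in> M \<rightarrow>\<^sub>M state_space"
      unfolding state_space_def using Xm[OF that] Em[OF that] by (rule measurable_Pair)
    from measurable_compose[OF this measurable_state_space_case[of \<phi>]] show ?thesis
      by (simp add: test_function_measurable[OF tf])
  qed
  have inc0: "AE \<omega> in M. \<forall>t\<ge>0. t < S\<^sub>0 \<omega> \<longrightarrow> (\<forall>j. \<bar>\<phi> j (X t \<omega>) - \<phi> j x\<bar> \<le> K * t)"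
    using Xint E0
  proof eventually_elim
    case (elim \<omega>)
    show ?case
    proof (intro allI impI)
      fix t j assume "0 \<le> t" "t < S\<^sub>0 \<omega>"
      then show "\<bar>\<phi> j (X t \<omega>) - \<phi> j x\<bar> \<le> K * t"
        using path_increment_before_second_jump[OF tf, of "\<lambda>s. E s \<omega>" "\<lambda>s. X s \<omega>" x "S\<^sub>0 \<omega>" t i j]
          elim i by auto
    qed
  qed
  have inc1: "AE \<omega> in M. \<forall>t\<ge>0. S\<^sub>0 \<omega> \<le> t \<and> t < S\<^sub>0 \<omega> + S\<^sub>1 \<omega> \<longrightarrow> (\<forall>j. \<bar>\<phi> j (X t \<omega>) - \<phi> j x\<bar> \<le> K * t)"
    using Xint E0 E1
  proof eventually_elim
    case (elim \<omega>)
    show ?case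
    proof (intro allI impI)
      fix t j assume "0 \<le> t" "S\<^sub>0 \<omega> \<le> t \<and> t < S\<^sub>0 \<omega> + S\<^sub>1 \<omega>"
      then show "\<bar>\<phi> j (X t \<omega>) - \<phi> j x\<bar> \<le> K * t"
        using path_increment_before_second_jump[OF tf, of "\<lambda>s. E s \<omega>" "\<lambda>s. X s \<omega>" x "S\<^sub>0 \<omega>" t i j]
          elim i by auto
    qed
  qed
  have Yint: "integrable M (\<lambda>\<omega>. \<phi> (E t \<omega>) (X t \<omega>))" if "0 \<le> t" for t
    using Ym[OF that] B by (intro integrable_const_bound[where B=B]) auto
  \<comment> \<open>\<open>J\<close> marks a jump by time \<open>t\<close>. \<open>JJ\<close> covers
    a second jump almost surely: positive holding times with sum at most \<open>t\<close> are both
    at most \<open>t\<close>.\<close>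
  define J where "J t \<omega> = (indicator {\<omega> \<in> space M. S\<^sub>0 \<omega> \<le> t} \<omega> :: real)" for t \<omega>
  define JJ where "JJ t \<omega> = (indicator {\<omega> \<in> space M. S\<^sub>0 \<omega> \<le> t \<and> S\<^sub>1 \<omega> \<le> t} \<omega> :: real)" for t \<omega>
  have Jm[measurable]: "J t \<in> borel_measurable M" "JJ t \<in> borel_measurable M" for t
    unfolding J_def[abs_def] JJ_def[abs_def] by measurable
  have Jint[simp]: "integrable M (J t)" "integrable M (JJ t)" for t
    by (rule integrable_const_bound[where B=1]; simp add: J_def JJ_def)+
  have EJ: "expectation (J t) = prob {\<omega> \<in> space M. S\<^sub>0 \<omega> \<le> t}"
    "expectation (JJ t) = prob {\<omega> \<in> space M. S\<^sub>0 \<omega> \<le> t \<and> S\<^sub>1 \<omega> \<le> t}" for t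
    unfolding J_def[abs_def] JJ_def[abs_def] by (auto intro!: arg_cong[where f=prob])
  have \<Delta>_eq: "\<Delta> t = (\<integral>\<omega>. \<phi> (E t \<omega>) (X t \<omega>) - \<phi> i x \<partial>M)" if "0 \<le> t" for t
    using Yint[OF that] by (simp add: \<Delta>_def prob_space)
  show bound: "\<bar>\<Delta> t\<bar> \<le> (K + 2 * B * \<kappa>\<^sub>i) * t" if t: "0 \<le> t" for t
  proof -
    \<comment> \<open>Before the first jump \<open>\<phi> i\<close> has moved by at most
      \<open>K * t\<close> along the path; after it the crude bound \<open>2 * B\<close> is
      enough.\<close>
    have "AE \<omega> in M. \<bar>\<phi> (E t \<omega>) (X t \<omega>) - \<phi> i x\<bar> \<le> K * t + 2 * B * J t \<omega>"
      using E0 inc0 AE_space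
    proof eventually_elim
      case (elim \<omega>)
      have "0 \<le> K * t" using K0 t by simp
      then show ?case using elim t BB[of "E t \<omega>" "X t \<omega>" i x]
        by (cases "t < S\<^sub>0 \<omega>") (auto simp: J_def)
    qed
    then have "\<bar>\<Delta> t\<bar> \<le> (\<integral>\<omega>. K * t + 2 * B * J t \<omega> \<partial>M)"
      unfolding \<Delta>_eq[OF t] using Yint[OF t]
      by (intro order_trans[OF integral_abs_bound] integral_mono_AE) auto
    also have "\<dots> = K * t + 2 * B * prob {\<omega> \<in> space M. S\<^sub>0 \<omega> \<le> t}"
      by (simp add: EJ prob_space)
    also have "\<dots> \<le> K * t + 2 * B * (\<kappa>\<^sub>i * t)"
      using pS_le[OF t] B0 by (intro add_left_mono mult_left_mono) auto
    finally show ?thesis by (simp add: algebra_simps)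
  qed
  \<comment> \<open>\<open>D\<close> is the increment on the paths without a jump and vanishes on
    the others.\<close>
  define D where "D t \<omega> = (if t < S\<^sub>0 \<omega> then \<phi> i (X t \<omega>) - \<phi> i x else 0)" for t \<omega>
  have Dm[measurable]: "D t \<in> borel_measurable M" if "0 \<le> t" for t
    using Xm[OF that] unfolding D_def[abs_def] by measurable
  have Dint: "integrable M (D t)" if "0 \<le> t" for t
    using Dm[OF that] BB B0 by (intro integrable_const_bound[where B="2*B"]) (auto simp: D_def)
  \<comment> \<open>\<open>1 - exp (- t * \<kappa>\<^sub>i)\<close> is the expectation of
    \<open>J t\<close>, so the last term charges a jump with the change of component at the starting
    point \<open>x\<close>.\<close>
  have rem: "\<bar>\<Delta> t - expectation (D t) - (1 - exp (- t * \<kappa>\<^sub>i)) * (\<phi> (- i) x - \<phi> i x)\<bar>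
      \<le> (K * \<kappa>\<^sub>i + 2 * B * \<kappa>\<^sub>i * \<kappa>\<^sub>j) * t\<^sup>2" if t: "0 \<le> t" for t
  proof -
    let ?R = "\<lambda>\<omega>. \<phi> (E t \<omega>) (X t \<omega>) - \<phi> i x - D t \<omega> - J t \<omega> * (\<phi> (- i) x - \<phi> i x)"
    \<comment> \<open>The remainder is 0 without a jump. After exactly one jump it is
      \<open>\<phi> (- i) (X t \<omega>) - \<phi> (- i) x\<close>, hence at most
      \<open>K * t\<close> in modulus; otherwise it is at most \<open>2 * B\<close>.\<close>
    have "AE \<omega> in M. \<bar>?R \<omega>\<bar> \<le> K * t * J t \<omega> + 2 * B * JJ t \<omega>"
      using E0 E1 inc1 S_pos AE_space
    proof eventually_elim
      case (elim \<omega>)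
      have Kt: "0 \<le> K * t" using K0 t by simp
      consider "t < S\<^sub>0 \<omega>" | "S\<^sub>0 \<omega> \<le> t" "t < S\<^sub>0 \<omega> + S\<^sub>1 \<omega>" | "S\<^sub>0 \<omega> + S\<^sub>1 \<omega> \<le> t"
        by linarith
      then show ?case
      proof cases
        case 1
        then show ?thesis using elim t by (simp add: D_def J_def JJ_def)
      next
        case 2
        then have "\<bar>?R \<omega>\<bar> \<le> K * t" using elim t by (simp add: D_def J_def)
        moreover have "0 \<le> 2 * B * JJ t \<omega>" using B0 by (simp add: JJ_def)
        ultimately show ?thesis using 2 elim by (simp add: J_def)
      next
        case 3
        then have "\<bar>?R \<omega>\<bar> \<le> 2 * B" using elim t BB[of "E t \<omega>" "X t \<omega>" "- i" x]
          by (simp add: D_def J_def)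
        then show ?thesis using 3 elim Kt by (simp add: J_def JJ_def)
      qed
    qed
    then have "\<bar>expectation ?R\<bar> \<le> (\<integral>\<omega>. K * t * J t \<omega> + 2 * B * JJ t \<omega> \<partial>M)"
      using Yint[OF t] Dint[OF t]
      by (intro order_trans[OF integral_abs_bound] integral_mono_AE) auto
    also have "\<dots> = K * t * prob {\<omega> \<in> space M. S\<^sub>0 \<omega> \<le> t}
        + 2 * B * prob {\<omega> \<in> space M. S\<^sub>0 \<omega> \<le> t \<and> S\<^sub>1 \<omega> \<le> t}"
      by (simp add: EJ)
    also have "\<dots> \<le> K * t * (\<kappa>\<^sub>i * t) + 2 * B * ((\<kappa>\<^sub>i * t) * (\<kappa>\<^sub>j * t))"
      using pS_le[OF t] pSS[OF t] B0 K0 t by (intro add_mono mult_left_mono) auto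
    finally have "\<bar>expectation ?R\<bar> \<le> (K * \<kappa>\<^sub>i + 2 * B * \<kappa>\<^sub>i * \<kappa>\<^sub>j) * t\<^sup>2"
      by (simp add: algebra_simps power2_eq_square)
    moreover have "expectation ?R = \<Delta> t - expectation (D t)
        - (1 - exp (- t * \<kappa>\<^sub>i)) * (\<phi> (- i) x - \<phi> i x)"
      unfolding \<Delta>_eq[OF t] using Yint[OF t] Dint[OF t] by (simp add: EJ pS[OF t])
    ultimately show ?thesis by simp
  qed
  define \<tau> where "\<tau> n = inverse (real (Suc n))" for n
  have \<tau>: "0 < \<tau> n" for n by (simp add: \<tau>_def)
  have \<tau>0: "filterlim \<tau> (at_right 0) sequentially"
    using LIMSEQ_inverse_real_of_nat unfolding \<tau>_def[abs_def] by (auto intro!: tendsto_imp_filterlim_at_right)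
  have L1: "(\<lambda>n. expectation (\<lambda>\<omega>. D (\<tau> n) \<omega> / \<tau> n))
      \<longlonglongrightarrow> expectation (\<lambda>\<omega>. vector_field pm pp i x * \<phi>' i x)"
  proof (rule integral_dominated_convergence[where w="\<lambda>_. K"])
    show "(\<lambda>\<omega>. D (\<tau> n) \<omega> / \<tau> n) \<in> borel_measurable M" for n
      using Dm[of "\<tau> n"] \<tau>[of n] by (intro borel_measurable_divide borel_measurable_const) simp
    show "AE \<omega> in M. norm (D (\<tau> n) \<omega> / \<tau> n) \<le> K" for n
      using inc0
    proof eventually_elim
      case (elim \<omega>)
      then have "\<bar>D (\<tau> n) \<omega>\<bar> \<le> K * \<tau> n" using \<tau>[of n] K0 by (simp add: D_def)
      then show ?case using \<tau>[of n] by (simp add: abs_divide divide_le_eq)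
    qed
    show "AE \<omega> in M. (\<lambda>n. D (\<tau> n) \<omega> / \<tau> n) \<longlonglongrightarrow> vector_field pm pp i x * \<phi>' i x"
      using Xint E0 S_pos
    proof eventually_elim
      case (elim \<omega>)
      have "((\<lambda>s. (\<phi> i (X s \<omega>) - \<phi> i x) / s) \<longlongrightarrow> vector_field pm pp i x * \<phi>' i x) (at_right 0)"
      \<comment> \<open>Half of the first holding time keeps the closed interval
        \<open>{0..t}\<close> strictly before the first jump.\<close>
      proof (rule integral_curve_right_derivative[where t="S\<^sub>0 \<omega> / 2" and
            g="\<lambda>s. vector_field pm pp (E s \<omega>) (X s \<omega>)"])
        show "(\<phi> i has_real_derivative \<phi>' i y) (at y)" for y
          using tf by (simp add: test_function_def)
      qed (use elim in \<open>auto intro: continuous_vector_field\<close>)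
      from filterlim_compose[OF this \<tau>0]
      have "(\<lambda>n. (\<phi> i (X (\<tau> n) \<omega>) - \<phi> i x) / \<tau> n) \<longlonglongrightarrow> vector_field pm pp i x * \<phi>' i x" .
      moreover have "\<forall>\<^sub>F n in sequentially. (\<phi> i (X (\<tau> n) \<omega>) - \<phi> i x) / \<tau> n = D (\<tau> n) \<omega> / \<tau> n"
      proof -
        have "\<forall>\<^sub>F s in at_right 0. s < S\<^sub>0 \<omega>"
          using elim eventually_at_right_less by (auto simp: eventually_at_right_field)
        from eventually_compose_filterlim[OF this \<tau>0] show ?thesis
          by (rule eventually_mono) (simp add: D_def)
      qed
      ultimately show ?case by (rule Lim_transform_eventually)
    qed
  qed auto
  have L2: "(\<lambda>n. (1 - exp (- \<tau> n * \<kappa>\<^sub>i)) / \<tau> n) \<longlonglongrightarrow> \<kappa>\<^sub>i"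
  proof -
    have "((\<lambda>t. 1 - exp (- t * \<kappa>\<^sub>i)) has_real_derivative \<kappa>\<^sub>i) (at 0 within {0<..})"
      by (auto intro!: derivative_eq_intros)
    then have "((\<lambda>t. (1 - exp (- t * \<kappa>\<^sub>i)) / t) \<longlongrightarrow> \<kappa>\<^sub>i) (at_right 0)"
      by (simp add: has_field_derivative_iff)
    from filterlim_compose[OF this \<tau>0] show ?thesis .
  qed
  have "(\<lambda>n. \<Delta> (\<tau> n) / \<tau> n - expectation (\<lambda>\<omega>. D (\<tau> n) \<omega> / \<tau> n)
      - (1 - exp (- \<tau> n * \<kappa>\<^sub>i)) / \<tau> n * (\<phi> (- i) x - \<phi> i x)) \<longlonglongrightarrow> 0"
  proof (rule Lim_null_comparison)
    show "\<forall>\<^sub>F n in sequentially. norm (\<Delta> (\<tau> n) / \<tau> n - expectation (\<lambda>\<omega>. D (\<tau> n) \<omega> / \<tau> n)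
      - (1 - exp (- \<tau> n * \<kappa>\<^sub>i)) / \<tau> n * (\<phi> (- i) x - \<phi> i x)) \<le> (K * \<kappa>\<^sub>i + 2 * B * \<kappa>\<^sub>i * \<kappa>\<^sub>j) * \<tau> n"
    proof (intro always_eventually allI)
      fix n
      have "\<bar>\<Delta> (\<tau> n) - expectation (D (\<tau> n)) - (1 - exp (- \<tau> n * \<kappa>\<^sub>i)) * (\<phi> (- i) x - \<phi> i x)\<bar> / \<tau> n
          \<le> (K * \<kappa>\<^sub>i + 2 * B * \<kappa>\<^sub>i * \<kappa>\<^sub>j) * \<tau> n"
        using rem[of "\<tau> n"] \<tau>[of n] by (simp add: divide_le_eq power2_eq_square mult.assoc)
      then show "norm (\<Delta> (\<tau> n) / \<tau> n - expectation (\<lambda>\<omega>. D (\<tau> n) \<omega> / \<tau> n)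
      - (1 - exp (- \<tau> n * \<kappa>\<^sub>i)) / \<tau> n * (\<phi> (- i) x - \<phi> i x)) \<le> (K * \<kappa>\<^sub>i + 2 * B * \<kappa>\<^sub>i * \<kappa>\<^sub>j) * \<tau> n"
        using \<tau>[of n] by (simp add: diff_divide_distrib[symmetric] abs_divide)
    qed
    show "(\<lambda>n. (K * \<kappa>\<^sub>i + 2 * B * \<kappa>\<^sub>i * \<kappa>\<^sub>j) * \<tau> n) \<longlonglongrightarrow> 0"
      unfolding \<tau>_def by (intro tendsto_mult_right_zero LIMSEQ_inverse_real_of_nat)
  qed
  from tendsto_add[OF tendsto_add[OF this L1] tendsto_mult_right[OF L2, of "\<phi> (- i) x - \<phi> i x"]]
  have "(\<lambda>n. \<Delta> (\<tau> n) / \<tau> n) \<longlonglongrightarrow> vector_field pm pp i x * \<phi>' i x + \<kappa>\<^sub>i * (\<phi> (- i) x - \<phi> i x)"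
    by (simp add: prob_space)
  then show "(\<lambda>n. \<Delta> (inverse (real (Suc n))) / inverse (real (Suc n)))
         \<longlonglongrightarrow> generator pm pp lm lp \<phi> \<phi>' (x, i)"
    by (simp add: \<tau>_def generator_def \<kappa>\<^sub>i_def)
qed

text \<open>\<open>\<Delta> t z\<close> is the increment of the semigroup applied to the test
  function. Invariance makes its integral against \<open>\<mu>\<close> vanish for every
  \<open>t\<close>; dividing by \<open>t\<close> and letting \<open>t\<close> tend to 0 under the
  integral leaves the generator.\<close>

lemma invariant_prob_generator:
  fixes M :: "real \<times> int \<Rightarrow> 'w measure"
  assumes sp: "\<And>z. z \<in> space state_space \<Longrightarrow> switching_process pm pp lm lp (M z) z (X z) (E z)"
    and sg: "transition_semigroup M X E P"
    and inv: "invariant_prob P \<mu>"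
    and tf: "test_function pm pp \<phi> \<phi>' B K"
  shows "(\<integral>z. generator pm pp lm lp \<phi> \<phi>' z \<partial>\<mu>) = 0"
proof -
  interpret prob_space \<mu> using inv by (simp add: invariant_prob_def)
  have sets[measurable_cong]: "sets \<mu> = sets state_space" using inv by (simp add: invariant_prob_def)
  have space: "space \<mu> = UNIV \<times> {-1, 1}"
    using sets_eq_imp_space_eq[OF sets] space_state_space by simp
  have B: "\<bar>\<phi> j y\<bar> \<le> B" for j y using tf by (simp add: test_function_def)
  let ?\<phi> = "\<lambda>z. \<phi> (snd z) (fst z)"
  define \<Delta> where "\<Delta> t z = (\<integral>\<omega>. \<phi> (E z t \<omega>) (X z t \<omega>) \<partial>M z) - ?\<phi> z" for t z
  have \<phi>m[measurable]: "?\<phi> \<in> borel_measurable state_space"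
    using test_function_measurable(1)[OF tf] by (intro measurable_state_space_case)
  have \<phi>int: "integrable \<mu> ?\<phi>" using B by (intro integrable_const_bound[where B=B]) auto
  have P: "P t \<in> \<mu> \<rightarrow>\<^sub>M prob_algebra state_space" if "0 \<le> t" for t
    using sg that unfolding transition_semigroup_def by (simp cong: measurable_cong_sets add: sets)
  have Q: "(\<integral>y. ?\<phi> y \<partial>P t z) = \<Delta> t z + ?\<phi> z" if t: "0 \<le> t" and z: "z \<in> space \<mu>" for t z
  proof -
    have z': "z \<in> space state_space" using z space by (simp add: space_state_space)
    have "switching_chain lm lp (M z) (snd z) (E z)" "X z t \<in> borel_measurable (M z)"
      using sp[OF z'] t by (auto simp: switching_process_def)
    then have "(\<lambda>\<omega>. (X z t \<omega>, E z t \<omega>)) \<in> M z \<rightarrow>\<^sub>M state_space"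
      unfolding state_space_def using t by (intro measurable_Pair) (auto simp: switching_chain_def)
    moreover have "P t z = distr (M z) state_space (\<lambda>\<omega>. (X z t \<omega>, E z t \<omega>))"
      using sg t z' unfolding transition_semigroup_def by blast
    ultimately show ?thesis by (simp add: integral_distr \<Delta>_def)
  qed
  \<comment> \<open>Measurability in the starting point is inherited from the kernel
    \<open>P t\<close>, since the probability space \<open>M z\<close> itself varies with
    \<open>z\<close>.\<close>
  have \<Delta>m: "\<Delta> t \<in> borel_measurable \<mu>" if "0 \<le> t" for t
  proof -
    have "(\<lambda>z. \<integral>y. ?\<phi> y \<partial>P t z) \<in> borel_measurable \<mu>"
      using measurable_prob_algebraD[OF P[OF that]] by measurable
    then have "(\<lambda>z. (\<integral>y. ?\<phi> y \<partial>P t z) - ?\<phi> z) \<in> borel_measurable \<mu>" by measurable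
    then show ?thesis by (rule measurable_cong[THEN iffD1, rotated]) (simp add: Q that)
  qed
  have zz: "\<exists>x i. z = (x, i) \<and> i \<in> {-1, 1} \<and> switching_process pm pp lm lp (M z) (x, i) (X z) (E z)"
    if "z \<in> space \<mu>" for z
    using sp[of z] that space by (cases z) (auto simp: space_state_space)
  \<comment> \<open>The larger of the two rates makes the dominating constant independent of the
    state.\<close>
  define C where "C = K + 2 * B * max lm lp"
  have bound: "\<bar>\<Delta> t z\<bar> \<le> C * t" if t: "0 \<le> t" and z: "z \<in> space \<mu>" for t z
  proof -
    from zz[OF z] obtain x i where
      xi: "z = (x, i)" "i \<in> {-1, 1}" "switching_process pm pp lm lp (M z) (x, i) (X z) (E z)"
      by blast
    have "\<bar>\<Delta> t z\<bar> \<le> (K + 2 * B * jump_rate lm lp i) * t"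
      using short_time_bound[OF xi(3,2) tf t] xi(1) by (simp add: \<Delta>_def)
    also have "\<dots> \<le> C * t"
      using B[of 0 0] t unfolding C_def jump_rate_def
      by (intro mult_right_mono add_left_mono mult_left_mono) auto
    finally show ?thesis .
  qed
  have zero: "(\<integral>z. \<Delta> t z \<partial>\<mu>) = 0" if t: "0 \<le> t" for t
  proof -
    have "(\<integral>z. ?\<phi> z \<partial>\<mu>) = (\<integral>z. ?\<phi> z \<partial>(\<mu> \<bind> P t))"
      using inv t by (simp add: invariant_prob_def)
    also have "\<dots> = (\<integral>z. (\<integral>y. ?\<phi> y \<partial>P t z) \<partial>\<mu>)"
    proof (rule integral_bind[where K=state_space and B'=1])
      show "AE z in \<mu>. emeasure (P t z) (space (P t z)) \<le> ennreal 1"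
        using measurable_space[OF P[OF t]]
        by (auto simp: space_prob_algebra prob_space.emeasure_space_1)
    qed (use B P[OF t] in \<open>auto intro: measurable_prob_algebraD finite_measure_axioms\<close>)
    also have "\<dots> = (\<integral>z. \<Delta> t z + ?\<phi> z \<partial>\<mu>)"
      by (intro Bochner_Integration.integral_cong refl Q[OF t])
    also have "\<dots> = (\<integral>z. \<Delta> t z \<partial>\<mu>) + (\<integral>z. ?\<phi> z \<partial>\<mu>)"
      using \<Delta>m[OF t] bound[OF t]
      by (intro Bochner_Integration.integral_add \<phi>int integrable_const_bound[where B="C * t"]) auto
    finally show ?thesis by simp
  qed
  have "(\<lambda>n. \<integral>z. \<Delta> (inverse (real (Suc n))) z / inverse (real (Suc n)) \<partial>\<mu>)
      \<longlonglongrightarrow> (\<integral>z. generator pm pp lm lp \<phi> \<phi>' z \<partial>\<mu>)"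
  proof (rule integral_dominated_convergence[where w="\<lambda>_. C"])
    show "generator pm pp lm lp \<phi> \<phi>' \<in> borel_measurable \<mu>"
      using measurable_generator[OF tf] by measurable
    show "(\<lambda>z. \<Delta> (inverse (real (Suc n))) z / inverse (real (Suc n))) \<in> borel_measurable \<mu>" for n
      using \<Delta>m[of "inverse (real (Suc n))"] by measurable
    show "AE z in \<mu>. norm (\<Delta> (inverse (real (Suc n))) z / inverse (real (Suc n))) \<le> C" for n
      using bound[of "inverse (real (Suc n))"]
      by (intro AE_I2) (auto simp: abs_mult field_simps simp del: of_nat_Suc)
    show "AE z in \<mu>. (\<lambda>n. \<Delta> (inverse (real (Suc n))) z / inverse (real (Suc n)))
        \<longlonglongrightarrow> generator pm pp lm lp \<phi> \<phi>' z"
    proof (rule AE_I2)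
      fix z assume "z \<in> space \<mu>"
      then obtain x i where
        xi: "z = (x, i)" "i \<in> {-1, 1}" "switching_process pm pp lm lp (M z) (x, i) (X z) (E z)"
        using zz by blast
      show "(\<lambda>n. \<Delta> (inverse (real (Suc n))) z / inverse (real (Suc n)))
        \<longlonglongrightarrow> generator pm pp lm lp \<phi> \<phi>' z"
        using short_time_limit[OF xi(3,2) tf] xi(1) by (simp add: \<Delta>_def)
    qed
  qed auto
  moreover have "(\<integral>z. \<Delta> (inverse (real (Suc n))) z / inverse (real (Suc n)) \<partial>\<mu>) = 0" for n
    using zero[of "inverse (real (Suc n))"] by simp
  ultimately show ?thesis by (simp add: LIMSEQ_const_iff)
qed

end

section \<open>Compactly supported functions\<close>

text \<open>The support interval is carried along explicitly so that it can be kept inside an open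
  interval on which reciprocals of the fields and of the integrating factor are continuous.\<close>

definition supported_continuous :: "real \<Rightarrow> real \<Rightarrow> (real \<Rightarrow> real) \<Rightarrow> bool" where
  "supported_continuous a b \<psi> \<longleftrightarrow> continuous_on UNIV \<psi> \<and> (\<forall>x. x \<notin> {a..b} \<longrightarrow> \<psi> x = 0)"

lemma supported_continuousI:
  "continuous_on UNIV \<psi> \<Longrightarrow> (\<And>x. x \<notin> {a..b} \<Longrightarrow> \<psi> x = 0) \<Longrightarrow> supported_continuous a b \<psi>"
  by (simp add: supported_continuous_def)

lemma supported_continuousD:
  assumes "supported_continuous a b \<psi>"
  shows "continuous_on A \<psi>" "x \<notin> {a..b} \<Longrightarrow> \<psi> x = 0" "\<psi> \<in> borel_measurable borel"
  using assms unfolding supported_continuous_def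
  by (auto intro: continuous_on_subset borel_measurable_continuous_onI)

lemma supported_continuous_bounded:
  assumes "supported_continuous a b \<psi>"
  obtains K where "0 \<le> K" "\<And>x. \<bar>\<psi> x\<bar> \<le> K"
proof -
  have "bounded (\<psi> ` {a..b})"
    by (intro compact_imp_bounded compact_continuous_image supported_continuousD[OF assms]) simp
  then obtain K where "\<And>x. x \<in> {a..b} \<Longrightarrow> \<bar>\<psi> x\<bar> \<le> K"
    unfolding bounded_iff by (metis imageI real_norm_def)
  then have "\<bar>\<psi> x\<bar> \<le> max K 0" for x
    using supported_continuousD(2)[OF assms, of x] by (cases "x \<in> {a..b}") fastforce+
  then show ?thesis using that[of "max K 0"] by simp
qed

lemma supported_continuous_integrable:
  assumes "supported_continuous a b \<psi>" "finite_measure m" "sets m = sets borel"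
  shows "integrable m \<psi>"
proof -
  interpret finite_measure m by fact
  obtain K where "\<And>x. \<bar>\<psi> x\<bar> \<le> K" using supported_continuous_bounded[OF assms(1)] by blast
  moreover have "\<psi> \<in> borel_measurable m"
    using supported_continuousD(3)[OF assms(1)] by (simp cong: measurable_cong_sets add: assms(3))
  ultimately show ?thesis by (intro integrable_const_bound[where B=K]) auto
qed

lemma supported_continuous_integrable_lborel:
  assumes "supported_continuous a b \<psi>"
  shows "integrable lborel \<psi>"
proof -
  have "integrable lborel (\<lambda>x. indicator {a..b} x *\<^sub>R \<psi> x)"
    by (intro borel_integrable_compact supported_continuousD[OF assms]) simp
  moreover have "(\<lambda>x. indicator {a..b} x *\<^sub>R \<psi> x) = \<psi>"
    using supported_continuousD(2)[OF assms] by (auto simp: indicator_def fun_eq_iff)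
  ultimately show ?thesis by simp
qed

text \<open>The product is continuous on \<open>S\<close> and vanishes off \<open>{a..b}\<close>;
  the set \<open>S\<close> and the complement of \<open>{a..b}\<close> are open and cover the line.
  Hence \<open>H\<close> may be singular at the ends of \<open>S\<close>, as the reciprocals of the
  fields are.\<close>

lemma supported_continuous_mult:
  assumes \<psi>: "supported_continuous a b \<psi>" and H: "continuous_on S H" "open S" "{a..b} \<subseteq> S"
  shows "supported_continuous a b (\<lambda>x. H x * \<psi> x)"
proof (rule supported_continuousI)
  have "continuous_on (S \<union> - {a..b}) (\<lambda>x. H x * \<psi> x)"
  proof (rule continuous_on_open_Un)
    show "continuous_on S (\<lambda>x. H x * \<psi> x)"
      by (intro continuous_intros H supported_continuousD[OF \<psi>])
    have "continuous_on (- {a..b}) (\<lambda>x. 0 :: real)" by simp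
    then show "continuous_on (- {a..b}) (\<lambda>x. H x * \<psi> x)"
      by (rule continuous_on_cong[THEN iffD1, rotated -1])
        (use supported_continuousD(2)[OF \<psi>] in auto)
  qed (use H in auto)
  moreover have "S \<union> - {a..b} = UNIV" using H by auto
  ultimately show "continuous_on UNIV (\<lambda>x. H x * \<psi> x)" by simp
qed (use supported_continuousD(2)[OF \<psi>] in auto)

lemma supported_continuous_mono:
  assumes "supported_continuous a b \<psi>" "{a..b} \<subseteq> {c..d}"
  shows "supported_continuous c d \<psi>"
  using assms unfolding supported_continuous_def by blast

lemma supported_continuous_antiderivative:
  assumes \<psi>: "supported_continuous a b \<psi>"
  obtains u where "\<And>x. (u has_real_derivative \<psi> x) (at x)"
    "\<And>x. x < a \<Longrightarrow> u x = 0" "\<And>x. b < x \<Longrightarrow> u x = (\<integral>x. \<psi> x \<partial>lborel)"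
proof
  \<comment> \<open>Starting at \<open>a - 1\<close> makes every point from \<open>a\<close> on
    interior, which gives a two-sided derivative; for \<open>x < a - 1\<close> the interval is empty
    and the integral is 0.\<close>
  let ?u = "\<lambda>x. integral {a - 1..x} \<psi>"
  have neg: "?u x = 0" if "x < a" for x
  proof -
    have "?u x = integral {a - 1..x} (\<lambda>_. 0)"
      by (rule integral_cong) (use that supported_continuousD(2)[OF \<psi>] in auto)
    then show ?thesis by simp
  qed
  then show "\<And>x. x < a \<Longrightarrow> ?u x = 0" .
  show "(?u has_real_derivative \<psi> x) (at x)" for x
  proof (cases "x < a")
    case True
    have "((\<lambda>_. 0) has_real_derivative \<psi> x) (at x)"
      using supported_continuousD(2)[OF \<psi>, of x] True by auto
    then show ?thesis
      by (rule has_field_derivative_transform_within_open[where S="{..<a}"]) (use True neg in auto)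
  next
    case False
    have "(?u has_real_derivative \<psi> x) (at x within {a - 1..x + 1})"
      using False by (intro integral_has_real_derivative supported_continuousD[OF \<psi>]) auto
    then show ?thesis using False by (simp add: at_within_Icc_at)
  qed
  show "?u x = (\<integral>x. \<psi> x \<partial>lborel)" if "b < x" for x
  proof -
    have "\<psi> integrable_on {a - 1..x}"
      by (intro integrable_continuous_real supported_continuousD[OF \<psi>])
    then have "(\<psi> has_integral ?u x) {a - 1..x}" by (rule integrable_integral)
    then have "(\<psi> has_integral ?u x) UNIV"
      by (rule has_integral_on_superset)
        (use that supported_continuousD(2)[OF \<psi>] in auto)
    moreover have "(\<psi> has_integral (\<integral>x. \<psi> x \<partial>lborel)) UNIV"
      by (intro has_integral_integral_lborel supported_continuous_integrable_lborel[OF \<psi>])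
    ultimately show ?thesis by (rule has_integral_unique)
  qed
qed

text \<open>Any two antiderivatives differ by a constant, and the one built above is 0 to the left
  of \<open>{a..b}\<close> and constant to the right of it.\<close>

lemma bounded_of_supported_derivative:
  assumes \<psi>: "supported_continuous a b \<psi>" and u: "\<And>x. (u has_real_derivative \<psi> x) (at x)"
  obtains B where "\<And>x. \<bar>u x :: real\<bar> \<le> B"
proof -
  obtain v where v: "\<And>x. (v has_real_derivative \<psi> x) (at x)"
    "\<And>x. x < a \<Longrightarrow> v x = 0" "\<And>x. b < x \<Longrightarrow> v x = (\<integral>x. \<psi> x \<partial>lborel)"
    using supported_continuous_antiderivative[OF \<psi>] by blast
  have "((\<lambda>x. u x - v x) has_real_derivative 0) (at x)" for x
    using DERIV_diff[OF u v(1)] by simp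
  then have uv: "u x - v x = u 0 - v 0" for x
    using DERIV_isconst_all[of "\<lambda>x. u x - v x" x 0] by blast
  have "continuous_on {a..b} v"
    using v(1) by (meson DERIV_isCont continuous_at_imp_continuous_on)
  then have "bounded (v ` {a..b})" by (intro compact_imp_bounded compact_continuous_image) auto
  then obtain K where K: "\<And>x. x \<in> {a..b} \<Longrightarrow> \<bar>v x\<bar> \<le> K"
    unfolding bounded_iff by (metis imageI real_norm_def)
  have "\<bar>v x\<bar> \<le> \<bar>K\<bar> + \<bar>\<integral>x. \<psi> x \<partial>lborel\<bar>" for x
    using K[of x] v(2)[of x] v(3)[of x] by (cases "x < a"; cases "b < x") auto
  then have "\<bar>u x\<bar> \<le> \<bar>u 0 - v 0\<bar> + (\<bar>K\<bar> + \<bar>\<integral>x. \<psi> x \<partial>lborel\<bar>)" for x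
    using uv[of x] by (smt (verit, best))
  then show ?thesis using that by blast
qed

text \<open>The cutoffs rise with \<open>n\<close> to the indicator of \<open>(a, r)\<close> and stay supported in a compact part of it.\<close>

lemma measure_eq_density_of_test_integrals:
  fixes m :: "real measure" and \<rho> :: "real \<Rightarrow> real"
  assumes fin: "finite_measure m" and sets[simp, measurable_cong]: "sets m = sets borel"
    and supp: "AE x in m. x \<in> {0<..<r}"
    and \<rho>: "continuous_on {0<..<r} \<rho>" "\<And>x. x \<in> {0<..<r} \<Longrightarrow> 0 \<le> \<rho> x"
    and eq: "\<And>a b \<psi>. 0 < a \<Longrightarrow> b < r \<Longrightarrow> supported_continuous a b \<psi> \<Longrightarrow> (\<And>x. 0 \<le> \<psi> x)
      \<Longrightarrow> (\<integral>x. \<psi> x \<partial>m) = (\<integral>x. \<rho> x * \<psi> x \<partial>lborel)"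
  shows "m = density lborel (\<lambda>x. ennreal (\<rho> x * indicator {0<..<r} x))"
proof (rule measure_eqI_lessThan)
  interpret finite_measure m by fact
  have \<rho>m[measurable]: "(\<lambda>x. \<rho> x * indicator {0<..<r} x) \<in> borel_measurable borel"
    using borel_measurable_continuous_on_indicator[OF _ \<rho>(1)] by (simp add: mult.commute)
  show "sets m = sets borel" by simp
  show "sets (density lborel (\<lambda>x. ennreal (\<rho> x * indicator {0<..<r} x))) = sets borel" by simp
  show "emeasure m {x<..} < \<infinity>" for x using emeasure_finite by (simp add: less_top[symmetric])
  fix y :: real
  \<comment> \<open>It suffices to compare the rays \<open>{y<..}\<close>. As both measures live on
    \<open>{0<..<r}\<close>, such a ray amounts to \<open>{a<..<r}\<close>.\<close>
  define a where "a = max y 0"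
  have a: "0 \<le> a" by (simp add: a_def)
  \<comment> \<open>A trapezoid that vanishes within distance \<open>1 / n\<close> of
    \<open>a\<close> and \<open>r\<close> and equals 1 at distance at least \<open>2 / n\<close>
    from both; for \<open>n = 0\<close> it is identically 0.\<close>
  define \<psi> where "\<psi> n x = max 0 (min 1 (min (real n * (x - a) - 1) (real n * (r - x) - 1)))" for n x
  have \<psi>0: "0 \<le> \<psi> n x" for n x by (simp add: \<psi>_def)
  have \<psi>_out: "\<psi> n x = 0" if "x \<notin> {a + 1 / real n..r - 1 / real n}" "n > 0" for n x
    using that by (auto simp: \<psi>_def field_simps max_def min_def)
  have sc: "supported_continuous (a + 1 / real n) (r - 1 / real n) (\<psi> n)" if "n > 0" for n
    using \<psi>_out[OF _ that] unfolding \<psi>_def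
    by (intro supported_continuousI) (auto intro!: continuous_intros)
  have \<psi>_zero: "\<psi> n x = 0" if "x \<notin> {a<..<r}" for n x
  proof -
    have "real n * (x - a) \<le> 0 \<or> real n * (r - x) \<le> 0"
      using that by (auto intro: mult_nonneg_nonpos)
    then show ?thesis by (auto simp: \<psi>_def)
  qed
  have mono: "\<psi> n x \<le> \<psi> (Suc n) x" for n x
  proof (cases "x \<in> {a<..<r}")
    case True
    then have "real n * (x - a) \<le> real (Suc n) * (x - a)" "real n * (r - x) \<le> real (Suc n) * (r - x)"
      by (auto intro!: mult_right_mono)
    then show ?thesis unfolding \<psi>_def by linarith
  qed (simp add: \<psi>_zero)
  have lim: "(\<lambda>n. \<psi> n x) \<longlonglongrightarrow> indicator {a<..<r} x" for x
  proof (cases "x \<in> {a<..<r}")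
    case True
    have "\<forall>\<^sub>F n in sequentially. 2 / (x - a) \<le> real n \<and> 2 / (r - x) \<le> real n"
      by (intro eventually_conj eventually_sequentiallyI[of "nat \<lceil>2 / (x - a)\<rceil>"]
          eventually_sequentiallyI[of "nat \<lceil>2 / (r - x)\<rceil>"]) linarith+
    then have "\<forall>\<^sub>F n in sequentially. \<psi> n x = 1"
      by eventually_elim (use True in \<open>auto simp: \<psi>_def field_simps\<close>)
    then show ?thesis using True by (simp add: tendsto_eventually)
  qed (simp add: \<psi>_zero)
  have \<psi>m[measurable]: "\<psi> n \<in> borel_measurable borel" for n
    unfolding \<psi>_def[abs_def] by measurable
  have conv: "(\<lambda>n. \<integral>\<^sup>+x. ennreal (\<psi> n x) \<partial>N) \<longlonglongrightarrow> emeasure N {a<..<r}"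
    if N: "sets N = sets borel" for N
  proof -
    have "(\<lambda>n. \<integral>\<^sup>+x. ennreal (\<psi> n x) \<partial>N) \<longlonglongrightarrow> (\<integral>\<^sup>+x. ennreal (indicator {a<..<r} x) \<partial>N)"
    proof (rule nn_integral_LIMSEQ)
      show "(\<lambda>x. ennreal (\<psi> n x)) \<in> borel_measurable N" for n
        by (subst measurable_cong_sets[OF N refl]) simp
      show "incseq (\<lambda>i x. ennreal (\<psi> i x))"
        using mono by (auto intro!: incseq_SucI le_funI ennreal_leI)
      show "(\<lambda>i. ennreal (\<psi> i x)) \<longlonglongrightarrow> ennreal (indicator {a<..<r} x)" for x
        using lim[of x] by (intro tendsto_ennrealI)
    qed
    also have "(\<integral>\<^sup>+x. ennreal (indicator {a<..<r} x) \<partial>N) = emeasure N {a<..<r}"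
      using N by (simp add: ennreal_indicator)
    finally show ?thesis .
  qed
  let ?D = "density lborel (\<lambda>x. ennreal (\<rho> x * indicator {0<..<r} x))"
  \<comment> \<open>A positive index leaves a margin at the end points, where \<open>\<rho>\<close>
    is not controlled; with \<open>1 / 0 = 0\<close> the index 0 would leave none.\<close>
  have nn_eq: "(\<integral>\<^sup>+x. ennreal (\<psi> n x) \<partial>m) = (\<integral>\<^sup>+x. ennreal (\<psi> n x) \<partial>?D)" if n: "n > 0" for n
  proof -
    have sub: "{a + 1 / real n..r - 1 / real n} \<subseteq> {0<..<r}"
    proof
      fix x assume "x \<in> {a + 1 / real n..r - 1 / real n}"
      moreover have "0 < 1 / real n" using n by simp
      ultimately show "x \<in> {0<..<r}" using a by (simp only: greaterThanLessThan_iff atLeastAtMost_iff) linarith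
    qed
    have sc2: "supported_continuous (a + 1 / real n) (r - 1 / real n) (\<lambda>x. \<rho> x * \<psi> n x)"
      by (rule supported_continuous_mult[OF sc[OF n] \<rho>(1) _ sub]) simp
    have \<rho>\<psi>: "0 \<le> \<rho> x * \<psi> n x" for x
      using \<rho>(2)[of x] \<psi>0[of n x] \<psi>_zero[of x n] a by (cases "x \<in> {0<..<r}") auto
    have "0 < a + 1 / real n" "r - 1 / real n < r" using n a by (auto intro: add_nonneg_pos)
    have "(\<integral>\<^sup>+x. ennreal (\<psi> n x) \<partial>m) = ennreal (\<integral>x. \<psi> n x \<partial>m)"
      using supported_continuous_integrable[OF sc[OF n] fin sets] \<psi>0
      by (intro nn_integral_eq_integral) auto
    also have "(\<integral>x. \<psi> n x \<partial>m) = (\<integral>x. \<rho> x * \<psi> n x \<partial>lborel)"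
      by (rule eq[OF _ _ sc[OF n] \<psi>0]) fact+
    also have "ennreal \<dots> = (\<integral>\<^sup>+x. ennreal (\<rho> x * \<psi> n x) \<partial>lborel)"
      using supported_continuous_integrable_lborel[OF sc2] \<rho>\<psi>
      by (intro nn_integral_eq_integral[symmetric]) auto
    also have "\<dots> = (\<integral>\<^sup>+x. ennreal (\<rho> x * indicator {0<..<r} x) * ennreal (\<psi> n x) \<partial>lborel)"
    proof (rule nn_integral_cong)
      fix x
      show "ennreal (\<rho> x * \<psi> n x) = ennreal (\<rho> x * indicator {0<..<r} x) * ennreal (\<psi> n x)"
        using \<rho>(2)[of x] \<psi>0[of n x] \<psi>_zero[of x n] a
        by (cases "x \<in> {0<..<r}") (auto simp: ennreal_mult)
    qed
    also have "\<dots> = (\<integral>\<^sup>+x. ennreal (\<psi> n x) \<partial>?D)"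
      by (subst nn_integral_density) auto
    finally show ?thesis .
  qed
  have "emeasure m {a<..<r} = emeasure ?D {a<..<r}"
  proof (rule LIMSEQ_unique[OF conv])
    show "(\<lambda>n. \<integral>\<^sup>+x. ennreal (\<psi> n x) \<partial>m) \<longlonglongrightarrow> emeasure ?D {a<..<r}"
      by (rule Lim_transform_eventually[OF conv])
        (auto intro!: eventually_sequentiallyI[of 1] simp: nn_eq)
  qed simp
  moreover have "emeasure m {y<..} = emeasure m {a<..<r}"
    by (rule emeasure_eq_AE) (use supp in \<open>auto simp: a_def\<close>)
  moreover have "emeasure ?D {y<..} = emeasure ?D {a<..<r}"
  proof -
    have "AE x in ?D. x \<in> {0<..<r}"
      by (subst AE_density, measurable) (auto simp: indicator_def)
    then show ?thesis by (intro emeasure_eq_AE) (auto simp: a_def)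
  qed
  ultimately show "emeasure m {y<..} = emeasure ?D {y<..}" by simp
qed

section \<open>The stationary equation on the half-line\<close>

text \<open>\<open>m\<close> and \<open>n\<close> stand for the parts of an invariant measure in the
  states 1 and -1, and \<open>stationary\<close> says that the generator integrates to 0. Compact
  support is asked of the derivatives: the test functions may be nonzero constants far out, which is
  what makes the net flux accessible.\<close>

locale stationary_pair =
  fixes pm pp lm lp :: real and m n :: "real measure"
  assumes pm: "pm < 0" and pp: "0 < pp" and lm: "0 < lm" and lp: "0 < lp"
    and fin_m: "finite_measure m" and fin_n: "finite_measure n"
    and sets_m[simp, measurable_cong]: "sets m = sets borel"
    and sets_n[simp, measurable_cong]: "sets n = sets borel"
    and pos_m: "AE x in m. 0 < x" and pos_n: "AE x in n. 0 < x"
    and stationary: "\<And>\<phi> \<psi> \<phi>' \<psi>' a b.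
      (\<And>x. (\<phi> has_real_derivative \<phi>' x) (at x)) \<Longrightarrow> supported_continuous a b \<phi>' \<Longrightarrow>
      (\<And>x. (\<psi> has_real_derivative \<psi>' x) (at x)) \<Longrightarrow> supported_continuous a b \<psi>' \<Longrightarrow>
      (\<integral>x. (pp * x - x ^ 3) * \<phi>' x + lp * (\<psi> x - \<phi> x) \<partial>m) +
      (\<integral>x. (pm * x - x ^ 3) * \<psi>' x + lm * (\<phi> x - \<psi> x) \<partial>n) = 0"
begin

sublocale m: finite_measure m by (rule fin_m)
sublocale n: finite_measure n by (rule fin_n)

definition r where "r = sqrt pp"
definition f where "f x = pp * x - x ^ 3"
definition h where "h x = pm * x - x ^ 3"

lemma r_pos: "0 < r" using pp by (simp add: r_def)
lemma r_sq: "r\<^sup>2 = pp" using pp by (simp add: r_def)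

lemma f_alt: "f x = x * (r - x) * (r + x)"
proof -
  have "x * (r - x) * (r + x) = r\<^sup>2 * x - x ^ 3"
    by (simp add: algebra_simps power2_eq_square power3_eq_cube)
  then show ?thesis by (simp add: f_def r_sq)
qed

lemma h_alt: "h x = - (x * (x\<^sup>2 - pm))"
  by (simp add: h_def algebra_simps power2_eq_square power3_eq_cube)

lemma interval_sq': "0 < x\<^sup>2 - pm"
  using pm zero_le_power2[of x] by linarith

lemma h_neg: "0 < x \<Longrightarrow> h x < 0"
  using interval_sq'[of x] by (simp add: h_alt)

lemma f_pos: "x \<in> {0<..<r} \<Longrightarrow> 0 < f x"
  by (simp add: f_alt)

lemma f_neg: "r < x \<Longrightarrow> f x < 0"
  using r_pos by (simp add: f_alt mult_pos_neg mult_neg_pos)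

lemma cont_fh: "continuous_on A f" "continuous_on A h"
  unfolding f_def[abs_def] h_def[abs_def] by (intro continuous_intros)+

lemma fh_measurable[measurable]: "f \<in> borel_measurable borel" "h \<in> borel_measurable borel"
  by (intro borel_measurable_continuous_onI cont_fh)+

lemma supported_continuous_fh:
  assumes "supported_continuous a b \<psi>"
  shows "supported_continuous a b (\<lambda>x. f x * \<psi> x)" "supported_continuous a b (\<lambda>x. h x * \<psi> x)"
  by (rule supported_continuous_mult[OF assms, where S=UNIV]; simp add: cont_fh)+

lemma integrable_m: "supported_continuous a b \<psi> \<Longrightarrow> integrable m \<psi>"
  by (rule supported_continuous_integrable) (auto intro: fin_m)

lemma integrable_n: "supported_continuous a b \<psi> \<Longrightarrow> integrable n \<psi>"
  by (rule supported_continuous_integrable) (auto intro: fin_n)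

section \<open>Net flux and the support of the two measures\<close>

lemma zero_net_flux:
  assumes \<psi>: "supported_continuous a b \<psi>"
  shows "(\<integral>x. f x * \<psi> x \<partial>m) + (\<integral>x. h x * \<psi> x \<partial>n) = 0"
proof -
  obtain u where u: "\<And>x. (u has_real_derivative \<psi> x) (at x)"
    by (rule supported_continuous_antiderivative[OF \<psi>]) (rule that)
  \<comment> \<open>The same antiderivative in both states cancels the switching terms.\<close>
  show ?thesis using stationary[OF u \<psi> u \<psi>] by (simp add: f_def h_def)
qed

lemma no_mass_above:
  "AE x in m. x \<le> r" "AE x in n. x \<le> r"
proof -
  have *: "(AE x in m. x \<notin> {r<..<b}) \<and> (AE x in n. x \<notin> {r<..<b})" for b
  proof -
    \<comment> \<open>A tent that is positive exactly on \<open>{r<..<b}\<close>, where both fields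
      are negative. The two flux integrals are therefore nonpositive with sum 0, so both integrands
      vanish almost everywhere.\<close>
    define \<psi> where "\<psi> x = max 0 (min (x - r) (b - x))" for x
    have \<psi>: "supported_continuous r b \<psi>"
      unfolding \<psi>_def[abs_def] by (intro supported_continuousI) (auto intro!: continuous_intros)
    note sc = supported_continuous_fh[OF \<psi>]
    have fle: "f x * \<psi> x \<le> 0" and hle: "h x * \<psi> x \<le> 0" for x
      using f_neg[of x] h_neg[of x] r_pos
      by (cases "r < x"; auto simp: \<psi>_def mult_nonpos_nonneg)+
    have "(\<integral>x. - (f x * \<psi> x) \<partial>m) + (\<integral>x. - (h x * \<psi> x) \<partial>n) = 0"
      using zero_net_flux[OF \<psi>] by simp
    moreover have "0 \<le> (\<integral>x. - (f x * \<psi> x) \<partial>m)" "0 \<le> (\<integral>x. - (h x * \<psi> x) \<partial>n)"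
      using fle hle by (auto intro!: Bochner_Integration.integral_nonneg simp del: integral_minus)
    ultimately have "(\<integral>x. - (f x * \<psi> x) \<partial>m) = 0" "(\<integral>x. - (h x * \<psi> x) \<partial>n) = 0"
      by linarith+
    then have AE: "AE x in m. - (f x * \<psi> x) = 0" "AE x in n. - (h x * \<psi> x) = 0"
      using integrable_m[OF sc(1)] integrable_n[OF sc(2)] fle hle
      by (auto simp: integral_nonneg_eq_0_iff_AE simp del: integral_minus)
    have nz: "f x * \<psi> x \<noteq> 0" "h x * \<psi> x \<noteq> 0" if "x \<in> {r<..<b}" for x
      using that f_neg[of x] h_neg[of x] r_pos by (auto simp: \<psi>_def)
    show ?thesis
    proof
      show "AE x in m. x \<notin> {r<..<b}" using AE(1) by (rule eventually_mono) (use nz(1) in force)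
      show "AE x in n. x \<notin> {r<..<b}" using AE(2) by (rule eventually_mono) (use nz(2) in force)
    qed
  qed
  \<comment> \<open>The intervals \<open>{r<..<real k}\<close> exhaust the ray beyond
    \<open>r\<close>, and countably many null sets may be united.\<close>
  have "AE x in m. \<forall>k::nat. x \<notin> {r<..<real k}" "AE x in n. \<forall>k::nat. x \<notin> {r<..<real k}"
    unfolding AE_all_countable using * by blast+
  moreover have "x \<le> r" if "\<forall>k::nat. x \<notin> {r<..<real k}" for x
    using that reals_Archimedean2[of x] by force
  ultimately show "AE x in m. x \<le> r" "AE x in n. x \<le> r"
    by (metis (mono_tags, lifting) eventually_mono)+
qed

text \<open>A bump at \<open>r\<close> of height 1 and half-width \<open>1 / sqrt k\<close>. For
  \<open>k = 0\<close> it is constantly 1, hence the restriction to \<open>0 < k\<close> wherever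
  compact support matters.\<close>

definition spike where "spike k x = max 0 (1 - real k * (x - r)\<^sup>2)"

lemma spike_bounds: "0 \<le> spike k x" "spike k x \<le> 1"
  by (auto simp: spike_def)

lemma continuous_spike: "continuous_on A (spike k)"
  unfolding spike_def[abs_def] by (intro continuous_intros)

lemma spike_support:
  assumes "0 < k" "x \<notin> {r - 1..r + 1}"
  shows "spike k x = 0"
proof -
  have "1 \<le> \<bar>x - r\<bar>" using assms by auto
  then have "1\<^sup>2 \<le> \<bar>x - r\<bar>\<^sup>2" by (intro power_mono) auto
  then have "1 * 1 \<le> real k * (x - r)\<^sup>2" using assms by (intro mult_mono) auto
  then show ?thesis by (simp add: spike_def)
qed

lemma spike_LIMSEQ: "(\<lambda>k. spike k x) \<longlonglongrightarrow> indicator {r} x"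
proof (cases "x = r")
  case True
  then show ?thesis by (simp add: spike_def)
next
  case False
  then have "0 < (x - r)\<^sup>2" by simp
  then have "\<forall>\<^sub>F k in sequentially. 1 / (x - r)\<^sup>2 \<le> real k"
    by (intro eventually_sequentiallyI[of "nat \<lceil>1 / (x - r)\<^sup>2\<rceil>"]) linarith
  then have "\<forall>\<^sub>F k in sequentially. spike k x = indicator {r} x"
    by eventually_elim (use False in \<open>auto simp: spike_def field_simps\<close>)
  then show ?thesis by (rule tendsto_eventually)
qed

lemma spike_measurable[measurable]: "spike k \<in> borel_measurable borel"
  by (intro borel_measurable_continuous_onI continuous_spike)

lemma spike_supported: "0 < k \<Longrightarrow> supported_continuous (r - 1) (r + 1) (spike k)"
  by (intro supported_continuousI continuous_spike spike_support)

text \<open>Letting the spikes shrink in the zero net flux leaves \<open>f r\<close> times the mass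
  of \<open>m\<close> at \<open>r\<close> plus \<open>h r\<close> times that of \<open>n\<close>.
  Since \<open>f r = 0\<close> and \<open>h r < 0\<close>, this excludes an atom of \<open>n\<close>
  and says nothing about \<open>m\<close>.\<close>

lemma no_atom_n: "measure n {r} = 0"
proof -
  obtain Bf where Bf: "\<And>x. x \<in> {0..r} \<Longrightarrow> \<bar>f x\<bar> \<le> Bf"
  proof -
    have "bounded (f ` {0..r})" by (intro compact_imp_bounded compact_continuous_image cont_fh) auto
    then show ?thesis using that unfolding bounded_iff by (metis imageI real_norm_def)
  qed
  obtain Bh where Bh: "\<And>x. x \<in> {0..r} \<Longrightarrow> \<bar>h x\<bar> \<le> Bh"
  proof -
    have "bounded (h ` {0..r})" by (intro compact_imp_bounded compact_continuous_image cont_fh) auto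
    then show ?thesis using that unfolding bounded_iff by (metis imageI real_norm_def)
  qed
  have "(\<lambda>k. \<integral>x. f x * spike k x \<partial>m) \<longlonglongrightarrow> (\<integral>x. f x * indicator {r} x \<partial>m)"
  proof (rule integral_dominated_convergence[where w="\<lambda>_. Bf"])
    show "AE x in m. norm (f x * spike k x) \<le> Bf" for k
      using pos_m no_mass_above(1)
    proof eventually_elim
      case (elim x)
      then have "\<bar>f x\<bar> * \<bar>spike k x\<bar> \<le> Bf * 1"
        using Bf[of x] spike_bounds[of k x] by (intro mult_mono) auto
      then show ?case by (simp add: abs_mult)
    qed
    show "AE x in m. (\<lambda>k. f x * spike k x) \<longlonglongrightarrow> f x * indicator {r} x"
      by (intro AE_I2 tendsto_mult_left spike_LIMSEQ)
  qed auto
  moreover have "(\<lambda>k. \<integral>x. h x * spike k x \<partial>n) \<longlonglongrightarrow> (\<integral>x. h x * indicator {r} x \<partial>n)"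
  proof (rule integral_dominated_convergence[where w="\<lambda>_. Bh"])
    show "AE x in n. norm (h x * spike k x) \<le> Bh" for k
      using pos_n no_mass_above(2)
    proof eventually_elim
      case (elim x)
      then have "\<bar>h x\<bar> * \<bar>spike k x\<bar> \<le> Bh * 1"
        using Bh[of x] spike_bounds[of k x] by (intro mult_mono) auto
      then show ?case by (simp add: abs_mult)
    qed
    show "AE x in n. (\<lambda>k. h x * spike k x) \<longlonglongrightarrow> h x * indicator {r} x"
      by (intro AE_I2 tendsto_mult_left spike_LIMSEQ)
  qed auto
  ultimately have "(\<lambda>k. (\<integral>x. f x * spike k x \<partial>m) + (\<integral>x. h x * spike k x \<partial>n))
      \<longlonglongrightarrow> (\<integral>x. f x * indicator {r} x \<partial>m) + (\<integral>x. h x * indicator {r} x \<partial>n)"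
    by (rule tendsto_add)
  moreover have "(\<lambda>k. (\<integral>x. f x * spike k x \<partial>m) + (\<integral>x. h x * spike k x \<partial>n)) \<longlonglongrightarrow> 0"
    by (rule tendsto_eventually, rule eventually_sequentiallyI[of 1])
      (rule zero_net_flux[OF spike_supported], simp)
  ultimately have "(\<integral>x. f x * indicator {r} x \<partial>m) + (\<integral>x. h x * indicator {r} x \<partial>n) = 0"
    by (rule LIMSEQ_unique)
  moreover have "(\<lambda>x. f x * indicator {r} x) = (\<lambda>x. 0)" "(\<lambda>x. h x * indicator {r} x) = (\<lambda>x. h r * indicator {r} x)"
    by (auto simp: f_alt indicator_def)
  ultimately show ?thesis using h_neg[OF r_pos] by simp
qed

text \<open>The flux cannot see an atom of \<open>m\<close> at \<open>r\<close>, because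
  \<open>f r = 0\<close>. Testing with a squared spike in state 1 and 0 in state -1 leaves, in the
  limit, \<open>lp\<close> times the atom of \<open>m\<close> against \<open>lm\<close> times that
  of \<open>n\<close>, and the latter is already known to be 0.\<close>

lemma no_atom_m: "measure m {r} = 0"
proof -
  \<comment> \<open>Squaring removes the kinks of the spike, so that the derivative is
    continuous.\<close>
  define \<phi> where "\<phi> k x = (spike k x)\<^sup>2" for k x
  define \<phi>' where "\<phi>' k x = 2 * spike k x * (- (2 * real k * (x - r)))" for k x
  have max_sq: "((\<lambda>y::real. (max 0 y)\<^sup>2) has_real_derivative 2 * max 0 y) (at y)" for y
  proof (cases y "0::real" rule: linorder_cases)
    case less
    have "((\<lambda>y::real. 0) has_real_derivative 2 * max 0 y) (at y)" using less by simp
    then show ?thesis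
      by (rule has_field_derivative_transform_within_open[where S="{..<0}"]) (use less in auto)
  next
    case greater
    have "((\<lambda>y::real. y\<^sup>2) has_real_derivative 2 * max 0 y) (at y)"
      using greater by (auto intro!: derivative_eq_intros)
    then show ?thesis
      by (rule has_field_derivative_transform_within_open[where S="{0<..}"]) (use greater in auto)
  next
    case equal
    have "((\<lambda>y::real. (max 0 y)\<^sup>2 / y) \<longlongrightarrow> 0) (at 0)"
    proof (rule Lim_null_comparison)
      show "\<forall>\<^sub>F y::real in at 0. norm ((max 0 y)\<^sup>2 / y) \<le> \<bar>y\<bar>"
        by (rule always_eventually) (auto simp: max_def power2_eq_square)
      show "((\<lambda>y::real. \<bar>y\<bar>) \<longlongrightarrow> 0) (at 0)" by (auto intro!: tendsto_eq_intros)
    qed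
    then show ?thesis using equal by (simp add: has_field_derivative_iff)
  qed
  have d: "(\<phi> k has_real_derivative \<phi>' k x) (at x)" for k x
  proof -
    have "((\<lambda>x. 1 - real k * (x - r)\<^sup>2) has_real_derivative - (2 * real k * (x - r))) (at x)"
      by (auto intro!: derivative_eq_intros)
    from DERIV_chain2[OF max_sq this] show ?thesis
      by (simp add: \<phi>_def[abs_def] \<phi>'_def spike_def)
  qed
  have sc: "supported_continuous (r - 1) (r + 1) (\<phi>' k)" if "0 < k" for k
    unfolding \<phi>'_def[abs_def] using spike_support[OF that]
    by (intro supported_continuousI continuous_intros continuous_spike) auto
  have sc\<phi>: "supported_continuous (r - 1) (r + 1) (\<phi> k)" if "0 < k" for k
    unfolding \<phi>_def[abs_def] using spike_support[OF that]
    by (intro supported_continuousI continuous_intros continuous_spike) auto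
  \<comment> \<open>The zero of \<open>f\<close> at \<open>r\<close> supplies a second factor
    \<open>x - r\<close>. As \<open>real k * (x - r)\<^sup>2 \<le> 1\<close> wherever the spike is
    nonzero, the product stays bounded in \<open>k\<close> on \<open>{0..r}\<close> although
    \<open>\<phi>' k\<close> does not.\<close>
  have \<phi>'_eq: "f x * \<phi>' k x = 4 * x * (r + x) * (real k * (x - r)\<^sup>2 * spike k x)" for k x
    by (simp add: f_alt \<phi>'_def algebra_simps power2_eq_square)
  have step: "(\<integral>x. f x * \<phi>' k x \<partial>m) - lp * (\<integral>x. \<phi> k x \<partial>m) + lm * (\<integral>x. \<phi> k x \<partial>n) = 0" if k: "0 < k" for k
  proof -
    have "supported_continuous (r - 1) (r + 1) (\<lambda>_. 0)" by (rule supported_continuousI) auto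
    then have "(\<integral>x. f x * \<phi>' k x + lp * (0 - \<phi> k x) \<partial>m) + (\<integral>x. h x * 0 + lm * (\<phi> k x - 0) \<partial>n) = 0"
      unfolding f_def h_def by (intro stationary[OF d sc[OF k]]) auto
    moreover have "(\<integral>x. f x * \<phi>' k x + lp * (0 - \<phi> k x) \<partial>m) = (\<integral>x. f x * \<phi>' k x \<partial>m) - lp * (\<integral>x. \<phi> k x \<partial>m)"
      using integrable_m[OF supported_continuous_fh(1)[OF sc[OF k]]] integrable_m[OF sc\<phi>[OF k]] by simp
    ultimately show ?thesis by simp
  qed
  have [measurable]: "\<phi> k \<in> borel_measurable borel" "\<phi>' k \<in> borel_measurable borel" for k
    unfolding \<phi>_def[abs_def] \<phi>'_def[abs_def] by measurable
  have "(\<lambda>k. \<integral>x. f x * \<phi>' k x \<partial>m) \<longlonglongrightarrow> (\<integral>x. 0 \<partial>m)"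
  proof (rule integral_dominated_convergence[where w="\<lambda>_. 4 * r * (2 * r)"])
    show "AE x in m. norm (f x * \<phi>' k x) \<le> 4 * r * (2 * r)" for k
      using pos_m no_mass_above(1)
    proof eventually_elim
      case (elim x)
      have "real k * (x - r)\<^sup>2 * spike k x \<le> 1"
      proof (cases "real k * (x - r)\<^sup>2 \<le> 1")
        case True
        then have "real k * (x - r)\<^sup>2 * spike k x \<le> 1 * 1"
          using spike_bounds[of k x] by (intro mult_mono) auto
        then show ?thesis by simp
      qed (simp add: spike_def)
      moreover have "0 \<le> real k * (x - r)\<^sup>2 * spike k x" using spike_bounds(1) by simp
      moreover have "4 * x * (r + x) \<le> 4 * r * (2 * r)"
        using elim r_pos by (intro mult_mono) auto
      moreover have "0 \<le> 4 * x * (r + x)" using elim r_pos by simp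
      ultimately have "4 * x * (r + x) * (real k * (x - r)\<^sup>2 * spike k x) \<le> 4 * r * (2 * r) * 1"
        and "0 \<le> 4 * x * (r + x) * (real k * (x - r)\<^sup>2 * spike k x)"
        by (blast intro: mult_mono order_trans mult_nonneg_nonneg)+
      then show ?case unfolding \<phi>'_eq by simp
    qed
    show "AE x in m. (\<lambda>k. f x * \<phi>' k x) \<longlonglongrightarrow> 0"
    proof (rule AE_I2)
      fix x
      show "(\<lambda>k. f x * \<phi>' k x) \<longlonglongrightarrow> 0"
      proof (cases "x = r")
        case False
        then have "0 < (x - r)\<^sup>2" by simp
        then have "\<forall>\<^sub>F k in sequentially. 1 / (x - r)\<^sup>2 \<le> real k"
          by (intro eventually_sequentiallyI[of "nat \<lceil>1 / (x - r)\<^sup>2\<rceil>"]) linarith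
        then have "\<forall>\<^sub>F k in sequentially. f x * \<phi>' k x = 0"
          by eventually_elim (use False in \<open>auto simp: spike_def \<phi>'_def field_simps\<close>)
        then show ?thesis by (rule tendsto_eventually)
      qed (simp add: \<phi>'_def)
    qed
  qed auto
  moreover have \<phi>1: "\<bar>\<phi> k x\<bar> \<le> 1" for k x
    using spike_bounds[of k x] by (simp add: \<phi>_def power_le_one)
  have \<phi>lim: "(\<lambda>k. \<phi> k x) \<longlonglongrightarrow> indicator {r} x" for x
  proof -
    have "(indicator {r} x :: real)\<^sup>2 = indicator {r} x" by (simp add: indicator_def)
    with tendsto_power[OF spike_LIMSEQ[of x], of 2] show ?thesis by (simp only: \<phi>_def)
  qed
  have "(\<lambda>k. \<integral>x. \<phi> k x \<partial>m) \<longlonglongrightarrow> (\<integral>x. indicator {r} x \<partial>m)"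
    by (rule integral_dominated_convergence[where w="\<lambda>_. 1"]) (auto simp: \<phi>1 \<phi>lim)
  moreover have "(\<lambda>k. \<integral>x. \<phi> k x \<partial>n) \<longlonglongrightarrow> (\<integral>x. indicator {r} x \<partial>n)"
    by (rule integral_dominated_convergence[where w="\<lambda>_. 1"]) (auto simp: \<phi>1 \<phi>lim)
  ultimately have "(\<lambda>k. (\<integral>x. f x * \<phi>' k x \<partial>m) - lp * (\<integral>x. \<phi> k x \<partial>m) + lm * (\<integral>x. \<phi> k x \<partial>n))
      \<longlonglongrightarrow> (\<integral>x. 0 \<partial>m) - lp * (\<integral>x. indicator {r} x \<partial>m) + lm * (\<integral>x. indicator {r} x \<partial>n)"
    by (intro tendsto_intros)
  moreover have "(\<lambda>k. (\<integral>x. f x * \<phi>' k x \<partial>m) - lp * (\<integral>x. \<phi> k x \<partial>m) + lm * (\<integral>x. \<phi> k x \<partial>n)) \<longlonglongrightarrow> 0"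
    by (rule tendsto_eventually, rule eventually_sequentiallyI[of 1]) (simp add: step)
  ultimately have "(\<integral>x. 0 \<partial>m) - lp * (\<integral>x. indicator {r} x \<partial>m) + lm * (\<integral>x. indicator {r} x \<partial>n) = 0"
    by (rule LIMSEQ_unique)
  then show ?thesis using lp no_atom_n by simp
qed

lemma AE_interval: "AE x in m. x \<in> {0<..<r}" "AE x in n. x \<in> {0<..<r}"
proof -
  have "AE x in m. x \<noteq> r"
    using no_atom_m by (intro AE_I[where N="{r}"]) (auto simp: m.emeasure_eq_measure)
  then show "AE x in m. x \<in> {0<..<r}" using pos_m no_mass_above(1) by eventually_elim auto
  have "AE x in n. x \<noteq> r"
    using no_atom_n by (intro AE_I[where N="{r}"]) (auto simp: n.emeasure_eq_measure)
  then show "AE x in n. x \<in> {0<..<r}" using pos_n no_mass_above(2) by eventually_elim auto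
qed

text \<open>\<open>G\<close> is the flux \<open>f \<rho>\<^sub>1 = - h \<rho>\<^sub>-\<^sub>1\<close> of the claimed densities, which solves \<open>G' = - (lm / h + lp / f) G\<close>.\<close>

definition G where
  "G x = x powr (- (lm / pm) - lp / pp) * (x\<^sup>2 - pm) powr (lm / (2 * pm)) * (pp - x\<^sup>2) powr (lp / (2 * pp))"

lemma interval_sq: "x \<in> {0<..<r} \<Longrightarrow> 0 < pp - x\<^sup>2"
  using power_strict_mono[of x r 2] by (simp add: r_sq)

lemma G_pos: "x \<in> {0<..<r} \<Longrightarrow> 0 < G x"
  using interval_sq[of x] interval_sq'[of x] by (simp add: G_def)

text \<open>The exponents in \<open>G\<close> come from partial fractions: integrating
  \<open>- lm / h\<close> gives logarithms of \<open>x\<close> and \<open>x\<^sup>2 - pm\<close>,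
  integrating \<open>- lp / f\<close> gives logarithms of \<open>x\<close> and
  \<open>pp - x\<^sup>2\<close>. On the interval \<open>F\<close> is \<open>G\<close> written as the
  exponential of their sum.\<close>

lemma G_deriv:
  assumes x: "x \<in> {0<..<r}"
  shows "(G has_real_derivative - (lm / h x + lp / f x) * G x) (at x)"
proof -
  define F where "F x = exp ((- (lm / pm) - lp / pp) * ln x + lm / (2 * pm) * ln (x\<^sup>2 - pm)
      + lp / (2 * pp) * ln (pp - x\<^sup>2))" for x
  have FG: "F y = G y" if "y \<in> {0<..<r}" for y
    using that interval_sq[OF that] interval_sq'[of y] by (simp add: F_def G_def powr_def exp_add)
  note pos = interval_sq[OF x] interval_sq'[of x]
  have nz: "pp - x\<^sup>2 \<noteq> 0" "x\<^sup>2 - pm \<noteq> 0" "x \<noteq> 0" "pm \<noteq> 0" "pp \<noteq> 0" using pos x pm pp by auto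
  have hf: "h x = - (x * (x\<^sup>2 - pm))" "f x = x * (pp - x\<^sup>2)"
    by (simp_all add: h_alt f_def algebra_simps power2_eq_square power3_eq_cube)
  have "(F has_real_derivative F x * ((- (lm / pm) - lp / pp) * (1 / x)
      + lm / (2 * pm) * (2 * x / (x\<^sup>2 - pm)) + lp / (2 * pp) * (- (2 * x) / (pp - x\<^sup>2)))) (at x)"
  proof -
    have l1: "(ln has_real_derivative 1 / x) (at x)"
      using x by (auto intro!: derivative_eq_intros)
    have l2: "((\<lambda>x. ln (x\<^sup>2 - pm)) has_real_derivative 2 * x / (x\<^sup>2 - pm)) (at x)"
      using pos by (auto intro!: derivative_eq_intros)
    have l3: "((\<lambda>x. ln (pp - x\<^sup>2)) has_real_derivative - (2 * x) / (pp - x\<^sup>2)) (at x)"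
      using pos by (auto intro!: derivative_eq_intros)
    show ?thesis
      unfolding F_def
      by (rule DERIV_chain2[OF DERIV_exp
            DERIV_add[OF DERIV_add[OF DERIV_cmult[OF l1] DERIV_cmult[OF l2]] DERIV_cmult[OF l3]]])
  qed
  also have "(- (lm / pm) - lp / pp) * (1 / x)
      + lm / (2 * pm) * (2 * x / (x\<^sup>2 - pm)) + lp / (2 * pp) * (- (2 * x) / (pp - x\<^sup>2))
      = - (lm / h x + lp / f x)"
  proof -
    have "- (lm / pm) * (1 / x) + lm / (2 * pm) * (2 * x / (x\<^sup>2 - pm)) = - (lm / h x)"
      unfolding hf using nz by (simp add: divide_simps) (simp add: algebra_simps power2_eq_square)
    moreover have "- (lp / pp) * (1 / x) + lp / (2 * pp) * (- (2 * x) / (pp - x\<^sup>2)) = - (lp / f x)"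
      unfolding hf using nz by (simp add: divide_simps) (simp add: algebra_simps power2_eq_square)
    ultimately show ?thesis by (simp add: algebra_simps)
  qed
  finally have "(F has_real_derivative - (lm / h x + lp / f x) * G x) (at x)"
    by (simp add: FG[OF x] mult.commute)
  then show ?thesis
    by (rule has_field_derivative_transform_within_open[where S="{0<..<r}"]) (use x FG in auto)
qed

lemma cont_G: "continuous_on {0<..<r} G"
  using G_deriv by (meson DERIV_isCont continuous_at_imp_continuous_on)

section \<open>Density of the flux with respect to Lebesgue measure\<close>

text \<open>The test function is \<open>u / G\<close> in state 1 and 0 in state -1, where
  \<open>u\<close> is an antiderivative of \<open>\<psi>\<close>. Differentiating
  \<open>1 / G\<close> produces exactly the terms that cancel the switching terms, once the integral
  against \<open>n\<close> has been rewritten by the vanishing net flux.\<close>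

lemma flux_orthogonal:
  assumes \<psi>: "supported_continuous a b \<psi>" and ab: "0 < a" "b < r"
    and I0: "(\<integral>x. \<psi> x \<partial>lborel) = 0"
  shows "(\<integral>x. f x / G x * \<psi> x \<partial>m) = 0"
proof -
  obtain u where u: "\<And>x. (u has_real_derivative \<psi> x) (at x)"
    "\<And>x. x < a \<Longrightarrow> u x = 0" "\<And>x. b < x \<Longrightarrow> u x = (\<integral>x. \<psi> x \<partial>lborel)"
    using supported_continuous_antiderivative[OF \<psi>] by blast
  have sub: "{a..b} \<subseteq> {0<..<r}" using ab by auto
  have "continuous_on UNIV u" using u(1) by (meson DERIV_isCont continuous_at_imp_continuous_on)
  \<comment> \<open>The zero integral of \<open>\<psi>\<close> makes \<open>u\<close> vanish to the
    right of \<open>b\<close> as well.\<close>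
  then have uc: "supported_continuous a b u"
    using u I0 by (intro supported_continuousI) (auto simp: not_le)
  note mult = supported_continuous_mult[OF _ _ open_greaterThanLessThan sub]
  have nz: "G x \<noteq> 0" "f x \<noteq> 0" "h x \<noteq> 0" if "x \<in> {0<..<r}" for x
    using G_pos[OF that] f_pos[OF that] h_neg[of x] that by auto
  define \<phi> where "\<phi> x = 1 / G x * u x" for x
  define \<phi>' where "\<phi>' x = 1 / G x * \<psi> x + (lm / h x + lp / f x) / G x * u x" for x
  have sc1: "supported_continuous a b (\<lambda>x. 1 / G x * \<psi> x)"
    by (intro mult \<psi> continuous_intros cont_G) (simp add: nz)
  have sc2: "supported_continuous a b (\<lambda>x. (lm / h x + lp / f x) / G x * u x)"
    by (intro mult uc continuous_intros cont_G cont_fh) (auto simp: nz)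
  have sc\<phi>': "supported_continuous a b \<phi>'"
    using sc1 sc2 unfolding \<phi>'_def supported_continuous_def by (auto intro!: continuous_intros)
  have sc\<phi>: "supported_continuous a b \<phi>"
    unfolding \<phi>_def[abs_def] by (intro mult uc continuous_intros cont_G) (simp add: nz)
  have d: "(\<phi> has_real_derivative \<phi>' x) (at x)" for x
  proof (cases "x \<in> {0<..<r}")
    case True
    then have "(\<phi> has_real_derivative
        (\<psi> x * G x - u x * (- (lm / h x + lp / f x) * G x)) / (G x * G x)) (at x)"
      using DERIV_divide[OF u(1) G_deriv[OF True]] nz(1)[OF True] by (simp add: \<phi>_def[abs_def])
    also have "(\<psi> x * G x - u x * (- (lm / h x + lp / f x) * G x)) / (G x * G x) = \<phi>' x"
      using nz(1)[OF True] by (simp add: \<phi>'_def field_simps)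
    finally show ?thesis .
  next
    case False
    then have x: "x \<in> - {a..b}" using sub by auto
    have "((\<lambda>_. 0) has_real_derivative \<phi>' x) (at x)"
      using supported_continuousD(2)[OF sc\<phi>', of x] x by auto
    then show ?thesis
      by (rule has_field_derivative_transform_within_open[where S="- {a..b}"])
        (use x supported_continuousD(2)[OF sc\<phi>] in \<open>auto intro: open_Compl\<close>)
  qed
  have sc0: "supported_continuous a b (\<lambda>x. 0)" by (rule supported_continuousI) auto
  have eq1: "(\<integral>x. f x * \<phi>' x + lp * (0 - \<phi> x) \<partial>m) + (\<integral>x. h x * 0 + lm * (\<phi> x - 0) \<partial>n) = 0"
    unfolding f_def h_def by (intro stationary[OF d sc\<phi>' _ sc0]) auto
  \<comment> \<open>Zero net flux for \<open>lm / h x * \<phi> x\<close> turns the integral of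
    \<open>lm * \<phi> x\<close> against \<open>n\<close> into one against \<open>m\<close>.\<close>
  have sc3: "supported_continuous a b (\<lambda>x. lm / h x * \<phi> x)"
    by (intro mult sc\<phi> continuous_intros cont_fh) (auto simp: nz)
  have hh: "h x * (lm / h x * \<phi> x) = lm * \<phi> x" for x
    using nz(3)[of x] supported_continuousD(2)[OF sc\<phi>, of x] subsetD[OF sub, of x] by (cases "x \<in> {0<..<r}") auto
  have eq2: "(\<integral>x. f x * (lm / h x * \<phi> x) \<partial>m) + (\<integral>x. lm * \<phi> x \<partial>n) = 0"
    using zero_net_flux[OF sc3] unfolding hh .
  have "(\<integral>x. f x * \<phi>' x + lp * (0 - \<phi> x) \<partial>m) - (\<integral>x. f x * (lm / h x * \<phi> x) \<partial>m) = 0"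
    using eq1 eq2 by simp
  then have "(\<integral>x. f x * \<phi>' x + lp * (0 - \<phi> x) - f x * (lm / h x * \<phi> x) \<partial>m) = 0"
    using integrable_m[OF supported_continuous_fh(1)[OF sc\<phi>']] integrable_m[OF sc\<phi>]
      integrable_m[OF supported_continuous_fh(1)[OF sc3]] by simp
  also have "(\<lambda>x. f x * \<phi>' x + lp * (0 - \<phi> x) - f x * (lm / h x * \<phi> x)) = (\<lambda>x. f x / G x * \<psi> x)"
  proof
    fix x
    show "f x * \<phi>' x + lp * (0 - \<phi> x) - f x * (lm / h x * \<phi> x) = f x / G x * \<psi> x"
    proof (cases "x \<in> {0<..<r}")
      case True
      then show ?thesis using nz[OF True] unfolding \<phi>'_def \<phi>_def by (simp add: field_simps)
    next
      case False
      then have "x \<notin> {a..b}" using sub by auto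
      then show ?thesis
        using supported_continuousD(2)[OF sc\<phi>] supported_continuousD(2)[OF sc\<phi>'] supported_continuousD(2)[OF \<psi>]
        by simp
    qed
  qed
  finally show ?thesis .
qed

text \<open>A linear functional that vanishes on all functions of zero integral is a multiple of the
  integral. Subtracting a multiple of one fixed bump reduces every \<open>\<psi>\<close> to this
  case, so the constant does not depend on the support interval.\<close>

lemma flux_constant:
  obtains c where "0 \<le> c"
    "\<And>a b \<psi>. supported_continuous a b \<psi> \<Longrightarrow> 0 < a \<Longrightarrow> b < r \<Longrightarrow>
      (\<integral>x. f x / G x * \<psi> x \<partial>m) = c * (\<integral>x. \<psi> x \<partial>lborel)"
proof -
  \<comment> \<open>A tent over the middle third of \<open>{0<..<r}\<close>, at a distance from both
    end points.\<close>
  define \<eta> where "\<eta> x = max 0 (min (x - r / 3) (2 * r / 3 - x))" for x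
  have \<eta>0: "0 \<le> \<eta> x" for x by (simp add: \<eta>_def)
  have \<eta>: "supported_continuous (r / 3) (2 * r / 3) \<eta>"
    unfolding \<eta>_def[abs_def] using r_pos by (intro supported_continuousI) (auto intro!: continuous_intros)
  define J where "J = (\<integral>x. \<eta> x \<partial>lborel)"
  have "J \<noteq> 0"
  proof
    assume "J = 0"
    then have "AE x in lborel. \<eta> x = 0"
      using supported_continuous_integrable_lborel[OF \<eta>] \<eta>0
      by (simp add: J_def integral_nonneg_eq_0_iff_AE)
    then have "AE x in lborel. x \<notin> {r / 3<..<2 * r / 3}"
      by (rule eventually_mono) (auto simp: \<eta>_def)
    then have "emeasure lborel {r / 3<..<2 * r / 3} = 0"
      using AE_iff_measurable[of "{r / 3<..<2 * r / 3}" lborel "\<lambda>x. x \<notin> {r / 3<..<2 * r / 3}"]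
      by (simp del: greaterThanLessThan_iff)
    then show False using r_pos by simp
  qed
  moreover have "0 \<le> J" unfolding J_def by (intro Bochner_Integration.integral_nonneg \<eta>0)
  ultimately have J: "0 < J" by simp
  define c where "c = (\<integral>x. f x / G x * \<eta> x \<partial>m) / J"
  have fG: "continuous_on {0<..<r} (\<lambda>x. f x / G x)"
    using G_pos by (intro continuous_intros cont_G cont_fh) (metis less_irrefl)
  show ?thesis
  proof (rule that[of c])
    have "0 \<le> f x / G x * \<eta> x" for x
      using f_pos[of x] G_pos[of x] \<eta>0[of x] supported_continuousD(2)[OF \<eta>, of x] r_pos
      by (cases "x \<in> {0<..<r}") auto
    then show "0 \<le> c" unfolding c_def using J by (intro divide_nonneg_pos Bochner_Integration.integral_nonneg)
    fix a b \<psi> assume \<psi>: "supported_continuous a b \<psi>" and ab: "0 < a" "b < r"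
    \<comment> \<open>A common support interval for \<open>\<psi>\<close> and \<open>\<eta>\<close>,
      still inside \<open>{0<..<r}\<close>.\<close>
    define A where "A = min a (r / 3)" define B where "B = max b (2 * r / 3)"
    have AB: "0 < A" "B < r" using ab r_pos by (auto simp: A_def B_def)
    then have sub: "{A..B} \<subseteq> {0<..<r}" by auto
    have \<psi>': "supported_continuous A B \<psi>" and \<eta>': "supported_continuous A B \<eta>"
      by (rule supported_continuous_mono[OF \<psi>] supported_continuous_mono[OF \<eta>]; auto simp: A_def B_def)+
    define k where "k = (\<integral>x. \<psi> x \<partial>lborel) / J"
    have sc: "supported_continuous A B (\<lambda>x. \<psi> x - k * \<eta> x)"
      using \<psi>' \<eta>' unfolding supported_continuous_def by (auto intro!: continuous_intros)
    have "(\<integral>x. \<psi> x - k * \<eta> x \<partial>lborel) = 0"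
      using supported_continuous_integrable_lborel[OF \<psi>'] supported_continuous_integrable_lborel[OF \<eta>'] J
      by (simp add: k_def J_def)
    from flux_orthogonal[OF sc AB this]
    have "(\<integral>x. f x / G x * (\<psi> x - k * \<eta> x) \<partial>m) = 0" .
    moreover have "f x / G x * (\<psi> x - k * \<eta> x) = f x / G x * \<psi> x - k * (f x / G x * \<eta> x)" for x
      by (simp add: right_diff_distrib)
    ultimately have "(\<integral>x. f x / G x * \<psi> x - k * (f x / G x * \<eta> x) \<partial>m) = 0"
      by (simp only:)
    moreover have "(\<integral>x. f x / G x * \<psi> x - k * (f x / G x * \<eta> x) \<partial>m) =
        (\<integral>x. f x / G x * \<psi> x \<partial>m) - k * (\<integral>x. f x / G x * \<eta> x \<partial>m)"
      using Bochner_Integration.integral_diff[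
          OF integrable_m[OF supported_continuous_mult[OF \<psi>' fG open_greaterThanLessThan sub]]
            integrable_mult_right[OF integrable_m[OF supported_continuous_mult[OF \<eta>' fG open_greaterThanLessThan sub]], of k]]
      by (simp only: integral_mult_right_zero)
    ultimately have "(\<integral>x. f x / G x * \<psi> x \<partial>m) = k * (\<integral>x. f x / G x * \<eta> x \<partial>m)"
      by linarith
    then show "(\<integral>x. f x / G x * \<psi> x \<partial>m) = c * (\<integral>x. \<psi> x \<partial>lborel)"
      by (simp add: c_def k_def)
  qed
qed

text \<open>The constant flux determines both measures: testing it with
  \<open>G x / f x * \<psi> x\<close> gives the density of \<open>m\<close>, and the vanishing net
  flux for \<open>1 / h x * \<psi> x\<close> transfers it to \<open>n\<close>. The minus sign before
  \<open>h\<close> makes the second density nonnegative.\<close>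

lemma stationary_densities:
  obtains c where "0 \<le> c"
    "m = density lborel (\<lambda>x. ennreal (c * (G x / f x) * indicator {0<..<r} x))"
    "n = density lborel (\<lambda>x. ennreal (c * (G x / - h x) * indicator {0<..<r} x))"
proof -
  obtain c where c: "0 \<le> c" and cI: "\<And>a b \<psi>. supported_continuous a b \<psi> \<Longrightarrow> 0 < a \<Longrightarrow> b < r \<Longrightarrow>
      (\<integral>x. f x / G x * \<psi> x \<partial>m) = c * (\<integral>x. \<psi> x \<partial>lborel)"
    by (rule flux_constant) (rule that; assumption)
  have nz: "G x \<noteq> 0" "f x \<noteq> 0" "h x \<noteq> 0" if "x \<in> {0<..<r}" for x
    using G_pos[OF that] f_pos[OF that] h_neg[of x] that by auto
  have Gf: "continuous_on {0<..<r} (\<lambda>x. G x / f x)" and Gh: "continuous_on {0<..<r} (\<lambda>x. G x / - h x)"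
    by (intro continuous_intros cont_G cont_fh; simp add: nz)+
  have int_m: "(\<integral>x. \<psi> x \<partial>m) = (\<integral>x. c * (G x / f x) * \<psi> x \<partial>lborel)"
    if ab: "0 < a" "b < r" and \<psi>: "supported_continuous a b \<psi>" for a b \<psi>
  proof -
    have sub: "{a..b} \<subseteq> {0<..<r}" using ab by auto
    have sc: "supported_continuous a b (\<lambda>x. G x / f x * \<psi> x)"
      by (rule supported_continuous_mult[OF \<psi> Gf _ sub]) simp
    have "f x / G x * (G x / f x * \<psi> x) = \<psi> x" for x
      using nz[of x] supported_continuousD(2)[OF \<psi>, of x] subsetD[OF sub, of x] by (cases "x \<in> {0<..<r}") auto
    then have "(\<integral>x. \<psi> x \<partial>m) = c * (\<integral>x. G x / f x * \<psi> x \<partial>lborel)"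
      using cI[OF sc ab] by (simp only:)
    then show ?thesis by (simp only: mult.assoc integral_mult_right_zero)
  qed
  have int_n: "(\<integral>x. \<psi> x \<partial>n) = (\<integral>x. c * (G x / - h x) * \<psi> x \<partial>lborel)"
    if ab: "0 < a" "b < r" and \<psi>: "supported_continuous a b \<psi>" for a b \<psi>
  proof -
    have sub: "{a..b} \<subseteq> {0<..<r}" using ab by auto
    have sc: "supported_continuous a b (\<lambda>x. 1 / h x * \<psi> x)"
      by (rule supported_continuous_mult[OF \<psi> _ _ sub])
        (auto intro!: continuous_intros cont_fh simp: nz)
    have eqs: "h x * (1 / h x * \<psi> x) = \<psi> x"
      "c * (G x / f x) * (f x * (1 / h x * \<psi> x)) = - (c * (G x / - h x) * \<psi> x)" for x
      using nz[of x] supported_continuousD(2)[OF \<psi>, of x] subsetD[OF sub, of x] by (cases "x \<in> {0<..<r}"; auto)+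
    have "(\<integral>x. \<psi> x \<partial>n) = - (\<integral>x. f x * (1 / h x * \<psi> x) \<partial>m)"
      using zero_net_flux[OF sc] unfolding eqs by linarith
    also have "\<dots> = - (\<integral>x. c * (G x / f x) * (f x * (1 / h x * \<psi> x)) \<partial>lborel)"
      by (subst int_m[OF ab supported_continuous_fh(1)[OF sc]]) simp
    finally show ?thesis unfolding eqs by simp
  qed
  show ?thesis
  proof (rule that[OF c])
    show "m = density lborel (\<lambda>x. ennreal (c * (G x / f x) * indicator {0<..<r} x))"
    proof (rule measure_eq_density_of_test_integrals)
      show "0 \<le> c * (G x / f x)" if "x \<in> {0<..<r}" for x
        using c G_pos[OF that] f_pos[OF that] by simp
      show "continuous_on {0<..<r} (\<lambda>x. c * (G x / f x))" by (intro continuous_on_mult_left Gf)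
      show "(\<integral>x. \<psi> x \<partial>m) = (\<integral>x. c * (G x / f x) * \<psi> x \<partial>lborel)"
        if "0 < a" "b < r" "supported_continuous a b \<psi>" for a b \<psi>
        using that by (rule int_m)
    qed (rule fin_m sets_m AE_interval)+
    show "n = density lborel (\<lambda>x. ennreal (c * (G x / - h x) * indicator {0<..<r} x))"
    proof (rule measure_eq_density_of_test_integrals)
      show "0 \<le> c * (G x / - h x)" if "x \<in> {0<..<r}" for x
        using c G_pos[OF that] h_neg[of x] that by (intro mult_nonneg_nonneg divide_nonneg_nonneg) auto
      show "continuous_on {0<..<r} (\<lambda>x. c * (G x / - h x))" by (intro continuous_on_mult_left Gh)
      show "(\<integral>x. \<psi> x \<partial>n) = (\<integral>x. c * (G x / - h x) * \<psi> x \<partial>lborel)"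
        if "0 < a" "b < r" "supported_continuous a b \<psi>" for a b \<psi>
        using that by (rule int_n)
    qed (rule fin_n sets_n AE_interval)+
  qed
qed

end

section \<open>Invariant densities\<close>

text \<open>The claimed density without its normalizing constant.\<close>

definition weight :: "real \<Rightarrow> real \<Rightarrow> real \<Rightarrow> real \<Rightarrow> int \<Rightarrow> real \<Rightarrow> real" where
  "weight pm pp lm lp i x =
     x powr (- (lm / pm) - lp / pp - 1)
       * (- pm + x\<^sup>2) powr (lm / (2 * pm) - (1 - real_of_int i) / 2)
       * (pp - x\<^sup>2) powr (lp / (2 * pp) - (1 + real_of_int i) / 2)
       * indicator {0<..<sqrt pp} x"

lemma weight_nonneg: "0 \<le> weight pm pp lm lp i x"
  by (simp add: weight_def)

lemma weight_measurable[measurable]: "weight pm pp lm lp i \<in> borel_measurable borel"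
  unfolding weight_def[abs_def] by measurable

text \<open>Dividing \<open>G\<close> by \<open>f x = x * (pp - x\<^sup>2)\<close> lowers the
  exponents of \<open>x\<close> and \<open>pp - x\<^sup>2\<close> by one; dividing by
  \<open>- h x = x * (- pm + x\<^sup>2)\<close> lowers those of \<open>x\<close> and
  \<open>- pm + x\<^sup>2\<close>. The terms with \<open>i\<close> in the exponents record which of
  the two happens.\<close>

lemma (in stationary_pair) weight_eq:
  "G x / f x * indicator {0<..<r} x = weight pm pp lm lp 1 x"
  "G x / - h x * indicator {0<..<r} x = weight pm pp lm lp (-1) x"
proof -
  have fh: "f x = x * (pp - x\<^sup>2)" "- h x = x * (- pm + x\<^sup>2)"
    by (simp_all add: h_alt f_def algebra_simps power2_eq_square power3_eq_cube)
  have eq: "x\<^sup>2 - pm = - pm + x\<^sup>2" by simp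
  have pos: "0 < - pm + x\<^sup>2" using interval_sq'[of x] by simp
  show "G x / f x * indicator {0<..<r} x = weight pm pp lm lp 1 x"
    "G x / - h x * indicator {0<..<r} x = weight pm pp lm lp (-1) x"
    using interval_sq[of x] pos unfolding G_def weight_def fh r_def[symmetric] eq
    by (auto simp: powr_diff indicator_def)
qed

section \<open>From the parts in the two states back to the product space\<close>

lemma sets_reference_measure: "sets reference_measure = sets state_space"
  unfolding reference_measure_def state_space_def by (rule sets_pair_measure_cong) auto

lemma nn_integral_reference_measure:
  assumes "g \<in> borel_measurable state_space"
  shows "(\<integral>\<^sup>+z. g z \<partial>reference_measure) = (\<integral>\<^sup>+x. g (x, 1) \<partial>lborel) + (\<integral>\<^sup>+x. g (x, -1) \<partial>lborel)"
proof -
  interpret C: sigma_finite_measure "count_space {-1, 1 :: int}"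
    by (rule sigma_finite_measure_count_space_finite) simp
  have g: "g \<in> borel_measurable (lborel \<Otimes>\<^sub>M count_space {-1, 1 :: int})"
    using assms unfolding reference_measure_def[symmetric] measurable_cong_sets[OF sets_reference_measure refl] .
  have [measurable]: "(\<lambda>x. g (x, j)) \<in> borel_measurable borel" if "j \<in> {-1, 1}" for j
  proof -
    have "(\<lambda>x. (x, j)) \<in> borel \<rightarrow>\<^sub>M lborel \<Otimes>\<^sub>M count_space {-1, 1}"
      using that by (intro measurable_Pair) auto
    from measurable_compose[OF this g] show ?thesis .
  qed
  have "(\<integral>\<^sup>+z. g z \<partial>reference_measure) = (\<integral>\<^sup>+x. \<integral>\<^sup>+j. g (x, j) \<partial>count_space {-1, 1} \<partial>lborel)"
    unfolding reference_measure_def by (rule C.nn_integral_fst[OF g, symmetric])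
  also have "\<dots> = (\<integral>\<^sup>+x. g (x, 1) + g (x, -1) \<partial>lborel)"
    by (intro nn_integral_cong) (simp add: nn_integral_count_space_finite add.commute)
  also have "\<dots> = (\<integral>\<^sup>+x. g (x, 1) \<partial>lborel) + (\<integral>\<^sup>+x. g (x, -1) \<partial>lborel)"
    by (rule nn_integral_add) auto
  finally show ?thesis .
qed

text \<open>The bounds in \<open>test_function\<close> are uniform over all integers
  \<open>j\<close>. As only two functions occur in each family, maxima over \<open>1\<close> and
  \<open>-1\<close> provide them.\<close>

lemma test_functionI:
  assumes d: "\<And>j x. (\<phi> j has_real_derivative \<phi>' j x) (at x)"
    and sc: "\<And>j. supported_continuous a b (\<phi>' j)"
    and two: "\<And>j. \<phi> j = \<phi> 1 \<or> \<phi> j = \<phi> (-1)" "\<And>j. \<phi>' j = \<phi>' 1 \<or> \<phi>' j = \<phi>' (-1)"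
  shows "\<exists>B K. test_function pm pp \<phi> \<phi>' B K"
proof -
  obtain B1 where B1: "\<And>x. \<bar>\<phi> 1 x\<bar> \<le> B1" by (rule bounded_of_supported_derivative[OF sc d]) (rule that)
  obtain B2 where B2: "\<And>x. \<bar>\<phi> (-1) x\<bar> \<le> B2" by (rule bounded_of_supported_derivative[OF sc d]) (rule that)
  have "\<exists>K. \<forall>x. \<bar>vector_field pm pp i x * \<phi>' j x\<bar> \<le> K" for i j
  proof -
    have "supported_continuous a b (\<lambda>x. vector_field pm pp i x * \<phi>' j x)"
      by (rule supported_continuous_mult[OF sc continuous_vector_field[of UNIV]]) auto
    then show ?thesis by (metis supported_continuous_bounded)
  qed
  then obtain K where K: "\<And>i j x. \<bar>vector_field pm pp i x * \<phi>' j x\<bar> \<le> K i j" by metis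
  let ?K = "max (max (K 1 1) (K 1 (-1))) (max (K (-1) 1) (K (-1) (-1)))"
  have "\<bar>vector_field pm pp i x * \<phi>' j x\<bar> \<le> ?K" if "i \<in> {-1, 1}" for i j x
    using that two(2)[of j] K[of i x 1] K[of i x "-1"] by auto
  moreover have "\<bar>\<phi> j x\<bar> \<le> max B1 B2" for j x
    using two(1)[of j] B1[of x] B2[of x] by auto
  ultimately have "test_function pm pp \<phi> \<phi>' (max B1 B2) ?K"
    unfolding test_function_def using d supported_continuousD(1)[OF sc] by blast
  then show ?thesis by blast
qed

text \<open>This is the restriction to state \<open>i\<close> projected to the line, not a
  conditional law: its total mass is that of state \<open>i\<close> under
  \<open>\<mu>\<close>.\<close>

definition marginal :: "(real \<times> int) measure \<Rightarrow> int \<Rightarrow> real measure" where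
  "marginal \<mu> i = distr (density \<mu> (\<lambda>z. ennreal (indicator {i} (snd z)))) borel fst"

text \<open>The measure enters through the generator identity and not through a process, so that the
  result also applies to a reflected measure without constructing a reflected process.\<close>

lemma generator_density:
  assumes rates: "pm < 0" "0 < pp" "0 < lm" "0 < lp"
    and \<mu>: "prob_space \<mu>" and sets: "sets \<mu> = sets state_space"
    and pos: "AE z in \<mu>. 0 < fst z"
    and gen: "\<And>\<phi> \<phi>' B K. test_function pm pp \<phi> \<phi>' B K \<Longrightarrow> (\<integral>z. generator pm pp lm lp \<phi> \<phi>' z \<partial>\<mu>) = 0"
  obtains c where "0 \<le> c"
    "\<mu> = density reference_measure (\<lambda>(x, i). ennreal (c * weight pm pp lm lp i x))"
proof -
  interpret prob_space \<mu> by (rule \<mu>)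
  have space: "space \<mu> = UNIV \<times> {-1, 1}"
    using sets_eq_imp_space_eq[OF sets] space_state_space by simp
  have fst_m[measurable]: "fst \<in> \<mu> \<rightarrow>\<^sub>M borel"
    unfolding measurable_cong_sets[OF sets refl] state_space_def by measurable
  have ind_m[measurable]: "(\<lambda>z. indicator {i} (snd z) :: real) \<in> borel_measurable \<mu>" for i :: int
    unfolding measurable_cong_sets[OF sets refl] by (rule measurable_state_space_case) simp
  let ?m = "marginal \<mu>"
  have sets_m: "sets (?m i) = sets borel" for i by (simp add: marginal_def)
  have emeasure_m: "emeasure (?m i) A = (\<integral>\<^sup>+z. ennreal (indicator {i} (snd z)) * indicator A (fst z) \<partial>\<mu>)"
    if A: "A \<in> sets borel" for A i
  proof -
    have "emeasure (?m i) A = emeasure (density \<mu> (\<lambda>z. ennreal (indicator {i} (snd z)))) (fst -` A \<inter> space \<mu>)"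
      unfolding marginal_def using A by (subst emeasure_distr) auto
    also have "\<dots> = (\<integral>\<^sup>+z. ennreal (indicator {i} (snd z)) * indicator (fst -` A \<inter> space \<mu>) z \<partial>\<mu>)"
      using measurable_sets[OF fst_m A] by (intro emeasure_density) auto
    also have "\<dots> = (\<integral>\<^sup>+z. ennreal (indicator {i} (snd z)) * indicator A (fst z) \<partial>\<mu>)"
      by (intro nn_integral_cong) (auto simp: indicator_def)
    finally show ?thesis .
  qed
  have fin: "finite_measure (?m i)" for i
  proof (rule finite_measureI)
    have "emeasure (?m i) UNIV \<le> (\<integral>\<^sup>+z. 1 \<partial>\<mu>)"
      using emeasure_m[of UNIV i]
      by (auto simp: indicator_def simp del: nn_integral_const intro!: nn_integral_mono)
    also have "\<dots> < \<infinity>" by (simp add: emeasure_space_1)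
    finally show "emeasure (?m i) (space (?m i)) \<noteq> \<infinity>" by (simp add: marginal_def)
  qed
  have int_m: "(\<integral>x. F x \<partial>?m i) = (\<integral>z. indicator {i} (snd z) * F (fst z) \<partial>\<mu>)"
    if [measurable]: "F \<in> borel_measurable borel" for F :: "real \<Rightarrow> real" and i
    unfolding marginal_def
    by (subst integral_distr) (auto simp: integral_density)
  have pos_m: "AE x in ?m i. 0 < x" for i
    unfolding marginal_def using pos
    by (subst AE_distr_iff) (auto simp: AE_density elim!: eventually_mono)
  interpret stationary_pair pm pp lm lp "?m 1" "?m (-1)"
  proof (rule stationary_pair.intro)
    fix \<phi> \<psi> \<phi>' \<psi>' :: "real \<Rightarrow> real" and a b
    assume d: "\<And>x. (\<phi> has_real_derivative \<phi>' x) (at x)" "\<And>x. (\<psi> has_real_derivative \<psi>' x) (at x)"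
      and sc: "supported_continuous a b \<phi>'" "supported_continuous a b \<psi>'"
    \<comment> \<open>The pair becomes a family over all integers by taking \<open>\<psi>\<close>
      off 1, so that just two functions occur.\<close>
    define \<Phi> where "\<Phi> j = (if j = 1 then \<phi> else \<psi>)" for j :: int
    define \<Phi>' where "\<Phi>' j = (if j = 1 then \<phi>' else \<psi>')" for j :: int
    have "\<exists>B K. test_function pm pp \<Phi> \<Phi>' B K"
      by (rule test_functionI[where a=a and b=b]) (auto simp: \<Phi>_def \<Phi>'_def d sc)
    then obtain B K where tf: "test_function pm pp \<Phi> \<Phi>' B K" by blast
    note [measurable] = test_function_measurable[OF tf, of 1, simplified \<Phi>_def \<Phi>'_def, simplified]
      test_function_measurable[OF tf, of "-1", simplified \<Phi>_def \<Phi>'_def, simplified]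
    define A where "A x = (pp * x - x ^ 3) * \<phi>' x + lp * (\<psi> x - \<phi> x)" for x
    define D where "D x = (pm * x - x ^ 3) * \<psi>' x + lm * (\<phi> x - \<psi> x)" for x
    have AD_m[measurable]: "A \<in> borel_measurable borel" "D \<in> borel_measurable borel"
      unfolding A_def[abs_def] D_def[abs_def] by measurable
    have B: "\<bar>\<phi> x\<bar> \<le> B" "\<bar>\<psi> x\<bar> \<le> B" for x
      using tf unfolding test_function_def by (metis \<Phi>_def one_neq_neg_one)+
    have K: "\<bar>vector_field pm pp i x * \<Phi>' j x\<bar> \<le> K" if "i \<in> {-1, 1}" for i j x
      using tf that unfolding test_function_def by blast
    have K': "\<bar>(pp * x - x ^ 3) * \<phi>' x\<bar> \<le> K" "\<bar>(pm * x - x ^ 3) * \<psi>' x\<bar> \<le> K" for x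
      using K[of 1 x 1] K[of "-1" x "-1"] by (auto simp: vector_field_def \<Phi>'_def)
    have bd: "\<bar>lp * (\<psi> x - \<phi> x)\<bar> \<le> lp * (2 * B)" "\<bar>lm * (\<phi> x - \<psi> x)\<bar> \<le> lm * (2 * B)" for x
      using B[of x] rates by (auto simp: abs_mult intro!: mult_left_mono)
    have AD: "\<bar>A x\<bar> \<le> K + lp * (2 * B)" "\<bar>D x\<bar> \<le> K + lm * (2 * B)" for x
      using K'[of x] bd[of x] unfolding A_def D_def by linarith+
    have int: "integrable \<mu> (\<lambda>z. indicator {i} (snd z) * F (fst z))"
      if [measurable]: "F \<in> borel_measurable borel" and F: "\<And>x. \<bar>F x\<bar> \<le> k"
      for F :: "real \<Rightarrow> real" and k and i :: int
    proof (rule integrable_const_bound[where B=k])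
      show "AE z in \<mu>. norm (indicator {i} (snd z) * F (fst z)) \<le> k"
        using order_trans[OF abs_ge_zero F] F by (auto simp: indicator_def)
    qed measurable
    have "0 = (\<integral>z. generator pm pp lm lp \<Phi> \<Phi>' z \<partial>\<mu>)" using gen[OF tf] by simp
    also have "\<dots> = (\<integral>z. indicator {1} (snd z) * A (fst z) + indicator {-1} (snd z) * D (fst z) \<partial>\<mu>)"
      by (intro Bochner_Integration.integral_cong refl)
        (auto simp: space generator_def vector_field_def jump_rate_def \<Phi>_def \<Phi>'_def A_def D_def)
    also have "\<dots> = (\<integral>x. A x \<partial>?m 1) + (\<integral>x. D x \<partial>?m (-1))"
      unfolding int_m[OF AD_m(1)] int_m[OF AD_m(2)]
      by (rule Bochner_Integration.integral_add[OF int[OF AD_m(1) AD(1)] int[OF AD_m(2) AD(2)]])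
    finally show "(\<integral>x. (pp * x - x ^ 3) * \<phi>' x + lp * (\<psi> x - \<phi> x) \<partial>?m 1) +
      (\<integral>x. (pm * x - x ^ 3) * \<psi>' x + lm * (\<phi> x - \<psi> x) \<partial>?m (-1)) = 0"
      unfolding A_def D_def by (rule sym)
  qed (rule rates fin sets_m pos_m)+
  obtain c where c: "0 \<le> c"
    and m1: "?m 1 = density lborel (\<lambda>x. ennreal (c * (G x / f x) * indicator {0<..<r} x))"
    and m2: "?m (-1) = density lborel (\<lambda>x. ennreal (c * (G x / - h x) * indicator {0<..<r} x))"
    by (rule stationary_densities) (rule that)
  let ?w = "\<lambda>i x. c * weight pm pp lm lp i x"
  have m: "?m i = density lborel (\<lambda>x. ennreal (?w i x))" if "i \<in> {-1, 1}" for i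
    using that m1 m2 by (auto simp only: mult.assoc weight_eq)
  let ?g = "\<lambda>(x, i). ennreal (?w i x)"
  have g_m[measurable]: "?g \<in> borel_measurable state_space"
    using measurable_state_space_case[of "\<lambda>i x. ?w i x"] by (simp add: case_prod_beta')
  have "\<mu> = density reference_measure ?g"
  proof (rule measure_eqI)
    show "sets \<mu> = sets (density reference_measure ?g)"
      by (simp add: sets sets_reference_measure)
    fix A assume A: "A \<in> sets \<mu>"
    \<comment> \<open>Cutting \<open>A\<close> into its sections over the two states reduces the
      claim to the two measures on the line.\<close>
    define S where "S i = (\<lambda>x. (x, i)) -` A" for i :: int
    have A': "A \<in> sets state_space" using A sets by simp
    have S: "S i \<in> sets borel" if "i \<in> {-1, 1}" for i
    proof -
      have "(\<lambda>x. (x, i)) \<in> borel \<rightarrow>\<^sub>M state_space"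
        using that unfolding state_space_def by (intro measurable_Pair) auto
      from measurable_sets[OF this A'] show ?thesis by (simp add: S_def)
    qed
    have "emeasure \<mu> A = (\<integral>\<^sup>+z. indicator A z \<partial>\<mu>)" using A by simp
    also have "\<dots> = (\<integral>\<^sup>+z. ennreal (indicator {1} (snd z)) * indicator (S 1) (fst z)
        + ennreal (indicator {-1} (snd z)) * indicator (S (-1)) (fst z) \<partial>\<mu>)"
      by (intro nn_integral_cong) (auto simp: space S_def indicator_def)
    also have "\<dots> = emeasure (?m 1) (S 1) + emeasure (?m (-1)) (S (-1))"
      using S by (subst nn_integral_add) (auto simp: emeasure_m)
    also have "\<dots> = (\<integral>\<^sup>+x. ?g (x, 1) * indicator A (x, 1) \<partial>lborel) + (\<integral>\<^sup>+x. ?g (x, -1) * indicator A (x, -1) \<partial>lborel)"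
      using S by (simp add: m emeasure_density S_def indicator_vimage)
    also have "\<dots> = (\<integral>\<^sup>+z. ?g z * indicator A z \<partial>reference_measure)"
      using A' by (subst nn_integral_reference_measure) auto
    also have "\<dots> = emeasure (density reference_measure ?g) A"
      using A' by (subst emeasure_density) (auto simp: sets_reference_measure cong: measurable_cong_sets)
    finally show "emeasure \<mu> A = emeasure (density reference_measure ?g) A" .
  qed
  with c show ?thesis by (rule that)
qed

section \<open>Reflection symmetry of the generator\<close>

definition reflect :: "real \<times> int \<Rightarrow> real \<times> int" where
  "reflect = (\<lambda>(x, i). (- x, i))"

lemma reflect_measurable[measurable]: "reflect \<in> state_space \<rightarrow>\<^sub>M state_space"
  unfolding reflect_def state_space_def by measurable

lemma reflect_reflect: "reflect (reflect z) = z"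
  by (cases z) (simp add: reflect_def)

lemma distr_reference_measure_reflect: "distr reference_measure state_space reflect = reference_measure"
proof -
  have C: "distr (count_space {-1, 1 :: int}) (count_space {-1, 1}) (\<lambda>i. i) = count_space {-1, 1}"
    by (rule distr_id)
  have "distr (lborel :: real measure) borel uminus \<Otimes>\<^sub>M distr (count_space {-1, 1 :: int}) (count_space {-1, 1}) (\<lambda>i. i)
      = distr (lborel \<Otimes>\<^sub>M count_space {-1, 1}) (borel \<Otimes>\<^sub>M count_space {-1, 1}) (\<lambda>(x, i). (- x, i))"
    by (rule pair_measure_distr) (auto simp: C intro: sigma_finite_measure_count_space_finite)
  then show ?thesis
    by (simp add: C lborel_distr_uminus reference_measure_def state_space_def reflect_def)
qed

text \<open>Both fields are odd, and the sign this produces is the one in the chain rule for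
  \<open>\<lambda>x. \<phi> j (- x)\<close>. The rates do not depend on the position.\<close>

lemma generator_reflect:
  "generator pm pp lm lp \<phi> \<phi>' (reflect z) =
     generator pm pp lm lp (\<lambda>j x. \<phi> j (- x)) (\<lambda>j x. - \<phi>' j (- x)) z"
  by (cases z) (simp add: generator_def reflect_def vector_field_def power3_eq_cube algebra_simps)

lemma test_function_reflect:
  assumes "test_function pm pp \<phi> \<phi>' B K"
  shows "test_function pm pp (\<lambda>j x. \<phi> j (- x)) (\<lambda>j x. - \<phi>' j (- x)) B K"
proof -
  have odd: "vector_field pm pp i x = - vector_field pm pp i (- x)" for i x
    by (simp add: vector_field_def power3_eq_cube)
  note tf = assms[unfolded test_function_def]
  show ?thesis
    unfolding test_function_def
  proof (intro conjI allI ballI)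
    fix j :: int and x :: real
    have "(\<phi> j has_real_derivative \<phi>' j (- x)) (at (- x))" using tf by simp
    then show "((\<lambda>x. \<phi> j (- x)) has_real_derivative - \<phi>' j (- x)) (at x)"
      unfolding DERIV_mirror .
    show "\<bar>\<phi> j (- x)\<bar> \<le> B" using tf by simp
    have c: "continuous_on UNIV (\<phi>' j)" using tf by simp
    have "continuous_on UNIV (\<lambda>x. \<phi>' j (- x))"
      by (rule continuous_on_compose2[OF c, of UNIV "\<lambda>x. - x"]) (auto intro!: continuous_intros)
    then show "continuous_on UNIV (\<lambda>x. - \<phi>' j (- x))" by (rule continuous_on_minus)
    fix i :: int assume "i \<in> {-1, 1}"
    then have "\<bar>vector_field pm pp i (- x) * \<phi>' j (- x)\<bar> \<le> K" using tf by blast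
    then show "\<bar>vector_field pm pp i x * - \<phi>' j (- x)\<bar> \<le> K" unfolding odd[of i x] by simp
  qed
qed

section \<open>The two measures and their common normalizing constant\<close>

theorem theorem3p2:
  fixes pm pp lm lp :: real
    and M :: "real \<times> int \<Rightarrow> 'w measure"
    and X :: "real \<times> int \<Rightarrow> real \<Rightarrow> 'w \<Rightarrow> real"
    and E :: "real \<times> int \<Rightarrow> real \<Rightarrow> 'w \<Rightarrow> int"
    and P :: "real \<Rightarrow> real \<times> int \<Rightarrow> (real \<times> int) measure"
    and \<mu> \<pi> :: "(real \<times> int) measure"
  assumes "pm < 0" and "0 < pp" and "0 < lm" and "0 < lp"
    and "lp / pp < - (lm / pm)"
    and "\<And>z. z \<in> space state_space \<Longrightarrow> switching_process pm pp lm lp (M z) z (X z) (E z)"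
    and "transition_semigroup M X E P"
    and "ergodic_invariant_prob P \<mu>" and "emeasure \<mu> ({0<..} \<times> {-1, 1}) = 1"
    and "ergodic_invariant_prob P \<pi>" and "emeasure \<pi> ({..<0} \<times> {-1, 1}) = 1"
  shows "absolutely_continuous reference_measure \<mu> \<and>
         absolutely_continuous reference_measure \<pi> \<and>
         (\<exists>C>0. \<exists>\<rho>\<mu> \<rho>\<pi> :: int \<Rightarrow> real \<Rightarrow> real.
            is_invariant_density \<mu> \<rho>\<mu> \<and> is_invariant_density \<pi> \<rho>\<pi> \<and>
            (\<forall>i\<in>{-1, 1}. \<forall>x. \<rho>\<mu> i x = \<rho>\<pi> i (- x) \<and>
               \<rho>\<mu> i x =
                 C * x powr (- (lm / pm) - lp / pp - 1)
                   * (- pm + x\<^sup>2) powr (lm / (2 * pm) - (1 - real_of_int i) / 2)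
                   * (pp - x\<^sup>2) powr (lp / (2 * pp) - (1 + real_of_int i) / 2)
                   * indicator {0<..<sqrt pp} x))"
proof -
  interpret switching_rates pm pp lm lp using assms(3,4) by unfold_locales
  have inv: "invariant_prob P \<mu>" "invariant_prob P \<pi>"
    using assms(8,10) unfolding ergodic_invariant_prob_def by blast+
  have prob: "prob_space \<mu>" "prob_space \<pi>" and sets: "sets \<mu> = sets state_space" "sets \<pi> = sets state_space"
    using inv unfolding invariant_prob_def by blast+
  interpret \<mu>: prob_space \<mu> by (rule prob)
  interpret \<pi>: prob_space \<pi> by (rule prob)
  have gen: "(\<integral>z. generator pm pp lm lp \<phi> \<phi>' z \<partial>\<nu>) = 0"
    if "invariant_prob P \<nu>" "test_function pm pp \<phi> \<phi>' B K" for \<phi> \<phi>' B K \<nu>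
    by (rule invariant_prob_generator[OF _ assms(7) that]) (rule assms(6))
  let ?W = "weight pm pp lm lp"
  have "AE z in \<mu>. z \<in> {0<..} \<times> {-1, 1}"
    using assms(9) by (intro \<mu>.AE_prob_1) (simp add: \<mu>.emeasure_eq_measure)
  then have pos: "AE z in \<mu>. 0 < fst z" by (rule eventually_mono) auto
  obtain c where c: "0 \<le> c" and \<mu>_eq: "\<mu> = density reference_measure (\<lambda>(x, i). ennreal (c * ?W i x))"
    by (rule generator_density[OF assms(1-4) prob(1) sets(1) pos gen[OF inv(1)]]) (assumption, rule that)
  \<comment> \<open>The reflected measure lives on the positive half-line, where the density is
    already known up to a constant.\<close>
  define \<pi>' where "\<pi>' = distr \<pi> state_space reflect"
  have refl_m: "reflect \<in> \<pi> \<rightarrow>\<^sub>M state_space"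
    unfolding measurable_cong_sets[OF sets(2) refl] by measurable
  interpret \<pi>': prob_space \<pi>' unfolding \<pi>'_def by (rule \<pi>.prob_space_distr[OF refl_m])
  have "AE z in \<pi>. z \<in> {..<0} \<times> {-1, 1}"
    using assms(11) by (intro \<pi>.AE_prob_1) (simp add: \<pi>.emeasure_eq_measure)
  then have "AE z in \<pi>. 0 < fst (reflect z)" by (rule eventually_mono) (auto simp: reflect_def)
  moreover have "{z \<in> space state_space. 0 < fst z} \<in> sets state_space"
    unfolding state_space_def by measurable
  ultimately have pos': "AE z in \<pi>'. 0 < fst z"
    unfolding \<pi>'_def using refl_m by (simp add: AE_distr_iff)
  have sets': "sets \<pi>' = sets state_space" by (simp add: \<pi>'_def)
  \<comment> \<open>A change of variables moves the reflection into the test function, to which the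
    identity for \<open>\<pi>\<close> applies.\<close>
  have gen': "(\<integral>z. generator pm pp lm lp \<phi> \<phi>' z \<partial>\<pi>') = 0"
    if "test_function pm pp \<phi> \<phi>' B K" for \<phi> \<phi>' B K
    unfolding \<pi>'_def integral_distr[OF refl_m measurable_generator[OF that]] generator_reflect
    by (rule gen[OF inv(2) test_function_reflect[OF that]])
  obtain c' where c': "0 \<le> c'" and \<pi>'_eq: "\<pi>' = density reference_measure (\<lambda>(x, i). ennreal (c' * ?W i x))"
    by (rule generator_density[OF assms(1-4) \<pi>'.prob_space_axioms sets' pos' gen']) (assumption, rule that)
  have W_m: "(\<lambda>(x, i). k * ?W i x) \<in> borel_measurable state_space" for k
    using measurable_state_space_case[of "\<lambda>i x. k * ?W i x"] by (simp add: case_prod_beta')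
  \<comment> \<open>The total mass of the weight, whose value is never computed:
    \<open>ennreal k * I = 1\<close> for a single \<open>k\<close> already shows that
    \<open>I\<close> is neither 0 nor infinite.\<close>
  define I where "I = (\<integral>\<^sup>+z. (\<lambda>(x, i). ennreal (?W i x)) z \<partial>reference_measure)"
  have mass: "ennreal k * I = 1"
    if k: "0 \<le> k" and "prob_space \<nu>" and \<nu>: "\<nu> = density reference_measure (\<lambda>(x, i). ennreal (k * ?W i x))" for k \<nu>
  proof -
    have m: "(\<lambda>(x, i). ennreal (j * ?W i x)) \<in> borel_measurable reference_measure" for j
      unfolding measurable_cong_sets[OF sets_reference_measure refl]
      using measurable_compose[OF W_m measurable_ennreal, of j] by (simp add: case_prod_beta')
    interpret \<nu>: prob_space \<nu> by fact
    have "1 = emeasure \<nu> (space reference_measure)"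
      using \<nu>.emeasure_space_1 by (simp add: \<nu>)
    also have "\<dots> = (\<integral>\<^sup>+z. (\<lambda>(x, i). ennreal (k * ?W i x)) z \<partial>reference_measure)"
      unfolding \<nu> using m[of k] by (subst emeasure_density) (auto intro!: nn_integral_cong)
    also have "\<dots> = (\<integral>\<^sup>+z. ennreal k * (\<lambda>(x, i). ennreal (?W i x)) z \<partial>reference_measure)"
      using k weight_nonneg by (intro nn_integral_cong) (auto simp: ennreal_mult)
    also have "\<dots> = ennreal k * I"
      unfolding I_def using m[of 1] by (intro nn_integral_cmult) simp
    finally show ?thesis by simp
  qed
  have cI: "ennreal c * I = 1" and c'I: "ennreal c' * I = 1"
    using mass[OF c prob(1) \<mu>_eq] mass[OF c' \<pi>'.prob_space_axioms \<pi>'_eq] by auto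
  \<comment> \<open>Multiplying by the unit formed with the other constant avoids a division by
    \<open>I\<close> in the extended reals.\<close>
  have "ennreal c = ennreal c * (ennreal c' * I)" by (simp add: c'I)
  also have "\<dots> = ennreal c' * (ennreal c * I)" by (simp add: mult_ac)
  finally have "ennreal c = ennreal c'" by (simp add: cI)
  then have cc: "c' = c" using c c' by simp
  have "c \<noteq> 0" using cI by auto
  then have c_pos: "0 < c" using c by simp
  \<comment> \<open>Reflection is an involution that preserves the reference measure, so reflecting
    \<open>\<pi>'\<close> back gives \<open>\<pi>\<close> and composes the density with the
    reflection.\<close>
  have \<pi>_eq: "\<pi> = density reference_measure (\<lambda>(x, i). ennreal (c * ?W i (- x)))"
  proof -
    let ?g = "\<lambda>(x, i). ennreal (c * ?W i (- x))"
    have g: "?g \<in> borel_measurable state_space"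
      using measurable_compose[OF measurable_compose[OF reflect_measurable W_m] measurable_ennreal, of c]
      by (simp add: reflect_def case_prod_beta')
    have refl_ref: "reflect \<in> reference_measure \<rightarrow>\<^sub>M state_space"
      unfolding measurable_cong_sets[OF sets_reference_measure refl] by measurable
    have "distr \<pi>' state_space reflect = distr \<pi> state_space (\<lambda>z. z)"
      unfolding \<pi>'_def by (subst distr_distr[OF reflect_measurable refl_m]) (simp add: comp_def reflect_reflect)
    also have "\<dots> = \<pi>" by (rule distr_id2[OF sets(2)[symmetric]])
    finally have "\<pi> = distr \<pi>' state_space reflect" by simp
    also have "\<pi>' = density reference_measure (\<lambda>z. ?g (reflect z))"
      unfolding \<pi>'_eq cc by (rule arg_cong[where f="density _"]) (auto simp: reflect_def)
    also have "distr \<dots> state_space reflect = density (distr reference_measure state_space reflect) ?g"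
      by (rule density_distr[OF g refl_ref, symmetric])
    finally show ?thesis by (simp add: distr_reference_measure_reflect)
  qed
  have W_refl[measurable]: "(\<lambda>x. c * ?W i (- x)) \<in> borel_measurable borel" for i
    by measurable
  have ac: "absolutely_continuous reference_measure \<mu>" "absolutely_continuous reference_measure \<pi>"
  proof -
    show "absolutely_continuous reference_measure \<mu>"
      unfolding \<mu>_eq by (rule absolutely_continuousI_density)
        (use measurable_compose[OF W_m measurable_ennreal, of c] in
          \<open>simp add: case_prod_beta' measurable_cong_sets[OF sets_reference_measure refl]\<close>)
    show "absolutely_continuous reference_measure \<pi>"
      unfolding \<pi>_eq by (rule absolutely_continuousI_density)
        (use measurable_compose[OF measurable_compose[OF reflect_measurable W_m] measurable_ennreal, of c] in
          \<open>simp add: reflect_def case_prod_beta' measurable_cong_sets[OF sets_reference_measure refl]\<close>)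
  qed
  have "is_invariant_density \<mu> (\<lambda>i x. c * ?W i x)" "is_invariant_density \<pi> (\<lambda>i x. c * ?W i (- x))"
    unfolding is_invariant_density_def using \<mu>_eq \<pi>_eq c weight_nonneg by auto
  then show ?thesis
    using ac c_pos
    by (intro conjI exI[of _ c] exI[of _ "\<lambda>i x. c * ?W i x"] exI[of _ "\<lambda>i x. c * ?W i (- x)"])
      (auto simp: weight_def mult.assoc)
qed

end
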